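(* Let $n\ge1$, $p>1$, $q>1$ with $q\neq2$, let $\Theta\subset\mathbb{R}^{n+1}$ be open and bounded, and let $(x_0,t_0)\in\partial\Theta$. Assume that for some $\theta>0$, $$\Theta\subset\{(x,t)\in\mathbb{R}^{n}\times\mathbb{R}:\ t-t_0>-\theta|x-x_0|^l\},$$ where $l\ge\frac{q}{q-1}$ if $1<q<2$, and $l>q$ if $q>2$. Then $(x_0,t_0)$ is regular with respect to $\Theta$ for the equation $\partial_t u=\Delta_p^q u$.
   Context: Equation. Points of $\mathbb{R}^{n+1}$ are written $(x,t)$, and $\nabla$, $\Delta$, $D^2$ act in $x$ only. The equation is (E): $\partial_t u=\Delta_p^q u$, where for $\nabla u\neq 0$, $\Delta_p^q u=|\nabla u|^{q-p}\operatorname{div}(|\nabla u|^{p-2}\nabla u)=F(\nabla u,D^2u)$ with $F(\eta,X)=|\eta|^{q-2}\operatorname{Tr}\big(X+(p-2)\tfrac{\eta\otimes\eta}{|\eta|^2}X\big)$ for $\eta\in\mathbb{R}^n\setminus\{0\}$ and $X$ a symmetric $n\times n$ matrix. Admissible functions. $\mathcal{F}(F)$ is the set of $f\in C^2([0,\infty))$ with $f(0)=f'(0)=f''(0)=0$, $f''(r)>0$ for all $r>0$, and $\lim_{x\to 0,\,x\ne 0}F(\nabla g(x),D^2g(x))=0$ for $g(x)=f(|x|)$. $\Sigma$ is the set of even $\sigma\in C^1(\mathbb{R})$ with $\sigma(0)=\sigma'(0)=0$ and $\sigma(r)>0$ for $r>0$. A function $\varphi\in C^2(\Theta)$ is admissible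 at $(x_0,t_0)\in\Theta$ if either $\nabla\varphi(x_0,t_0)\ne0$, or there are $\delta>0$, $f\in\mathcal{F}(F)$, $\sigma\in\Sigma$ such that $|\varphi(x,t)-\varphi(x_0,t_0)-\partial_t\varphi(x_0,t_0)(t-t_0)|\le f(|x-x_0|)+\sigma(t-t_0)$ for all $(x,t)\in B_\delta(x_0)\times(t_0-\delta,t_0+\delta)$. Viscosity supersolutions. $u:\Theta\to\mathbb{R}\cup\{\infty\}$ is a viscosity supersolution of (E) in $\Theta$ if (1) $u$ is lower semicontinuous; (2) $u$ is finite in a dense subset of $\Theta$; (3) whenever $\varphi\in C^2(\Theta)$ is admissible at $\xi\in\Theta$ and touches $u$ at $\xi$ from below (i.e. $\varphi(\xi)=u(\xi)$ and $\varphi<u$ in a punctured neighborhood of $\xi$), then $\partial_t\varphi(\xi)-\Delta_p^q\varphi(\xi)\ge0$ if $\nabla\varphi(\xi)\ne0$, and $\partial_t\varphi(\xi)\ge0$ if $\nabla\varphi(\xi)=0$. Perron solutions and regularity. For bounded $f:\partial\Theta\to\mathbb{R}$, $\mathcal{U}_f$ is the class of viscosity supersolutions $u$ of (E) in $\Theta$ that are bounded from below and satisfy $\liminf_{\Theta\ni\eta\to\xi}u(\eta)\ge f(\xi)$ for all $\xi\in\partial\Theta$; the upper Perron solution is $\overline{H}f(\xi)=\inf_{u\in\mathcal{U}_f}u(\xi)$, $\xi\in\Theta$. A point $\xi_0\in\partial\Theta$ is regular (with respect to $\Theta$) if $\lim_{\Theta\ni\xi\to\xi_0}\overline{H}f(\xi)=f(\xi_0)$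 for every $f\in C(\partial\Theta)$. *)

theory Defs
  imports "HOL-Analysis.Analysis"
begin

definition grad :: "(real^'n \<Rightarrow> real) \<Rightarrow> real^'n \<Rightarrow> real^'n" where
  "grad g x = (THE D. GDERIV g x :> D)"

definition hess :: "(real^'n \<Rightarrow> real) \<Rightarrow> real^'n \<Rightarrow> real^'n^'n" where
  "hess g x = jacobian (grad g) (at x)"

definition divergence :: "(real^'n \<Rightarrow> real^'n) \<Rightarrow> real^'n \<Rightarrow> real" where
  "divergence V x = trace (jacobian V (at x))"

definition tensor :: "real^'n \<Rightarrow> real^'n \<Rightarrow> real^'n^'n" where
  "tensor a b = (\<chi> i j. a $ i * b $ j)"

definition F_pq :: "real \<Rightarrow> real \<Rightarrow> real^'n \<Rightarrow> real^'n^'n \<Rightarrow> real" where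
  "F_pq p q \<eta> X =
     norm \<eta> powr (q - 2) * trace (X + ((p - 2) / (norm \<eta>)\<^sup>2) *\<^sub>R (tensor \<eta> \<eta> ** X))"

text \<open>Only meaningful at points where the gradient does not vanish.\<close>

definition Delta_pq :: "real \<Rightarrow> real \<Rightarrow> (real^'n \<Rightarrow> real) \<Rightarrow> real^'n \<Rightarrow> real" where
  "Delta_pq p q g x = norm (grad g x) powr (q - p) *
     divergence (\<lambda>y. norm (grad g y) powr (p - 2) *\<^sub>R grad g y) x"

lemma Delta_pq_eq_F_pq:
  fixes g :: "real^'n \<Rightarrow> real"
  assumes diff: "grad g differentiable at x" and nz: "grad g x \<noteq> 0"
  shows "Delta_pq p q g x = F_pq p q (grad g x) (hess g x)"
proof -
  define G where "G = grad g"
  define G' where "G' = frechet_derivative G (at x)"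
  have G: "(G has_derivative G') (at x)"
    using diff unfolding G_def G'_def by (simp add: frechet_derivative_works)
  define N where "N = norm (G x)"
  have N: "N > 0" using nz by (simp add: N_def G_def)
  have nd: "((\<lambda>y. norm (G y)) has_derivative (\<lambda>h. inner (G x) (G' h) / N)) (at x)"
  proof -
    have "(norm has_derivative (\<lambda>h. inner (sgn (G x)) h)) (at (G x))"
      using has_derivative_norm[of "G x"] nz by (simp add: G_def inner_commute)
    from has_derivative_compose[OF G this] show ?thesis
      by (simp add: sgn_div_norm N_def divide_inverse mult.commute)
  qed
  have pd: "((\<lambda>y. norm (G y) powr (p - 2)) has_derivative
      (\<lambda>h. (p - 2) * N powr (p - 4) * inner (G x) (G' h))) (at x)"
  proof -
    have "((\<lambda>z. z powr (p - 2)) has_real_derivative (p - 2) * N powr (p - 2 - 1)) (at N)"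
      using N by (rule has_real_derivative_powr)
    then have "((\<lambda>z. z powr (p - 2)) has_derivative (\<lambda>h. (p - 2) * N powr (p - 3) * h)) (at (norm (G x)))"
      by (simp add: has_field_derivative_def N_def)
    from has_derivative_compose[OF nd this]
    have *: "((\<lambda>y. norm (G y) powr (p - 2)) has_derivative
      (\<lambda>h. (p - 2) * N powr (p - 3) * (inner (G x) (G' h) / N))) (at x)" .
    have "N powr (p - 3) = N powr (p - 4) * N"
      using N powr_add[of N "p - 4" 1] by simp
    then have "(p - 2) * N powr (p - 3) * (inner (G x) (G' h) / N)
        = (p - 2) * N powr (p - 4) * inner (G x) (G' h)" for h
      using N by simp
    with * show ?thesis by simp
  qed
  define V where "V = (\<lambda>y. norm (G y) powr (p - 2) *\<^sub>R G y)"
  have V: "(V has_derivative (\<lambda>h. N powr (p - 2) *\<^sub>R G' h +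
      ((p - 2) * N powr (p - 4) * inner (G x) (G' h)) *\<^sub>R G x)) (at x)"
    unfolding V_def N_def using has_derivative_scaleR[OF pd G] by (simp add: N_def)
  define T where "T = (\<Sum>i\<in>UNIV. G' (axis i 1) $ i)"
  define S where "S = (\<Sum>i\<in>UNIV. inner (G x) (G' (axis i 1)) * G x $ i)"
  have div: "divergence V x = N powr (p - 2) * T + (p - 2) * N powr (p - 4) * S"
    unfolding divergence_def jacobian_def frechet_derivative_at[OF V, symmetric]
    by (simp add: trace_def matrix_def T_def S_def sum.distrib sum_distrib_left mult.assoc)
  have tr: "trace (hess g x + c *\<^sub>R (tensor (G x) (G x) ** hess g x)) = T + c * S" for c
  proof -
    have H: "hess g x = matrix G'"
      by (simp add: hess_def jacobian_def G'_def G_def)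
    show ?thesis
      unfolding H
      by (simp add: trace_def matrix_def tensor_def matrix_matrix_mult_def T_def S_def
          sum.distrib sum_distrib_left inner_vec_def sum_distrib_right mult_ac)
  qed
  have e1: "N powr (q - p) * N powr (p - 2) = N powr (q - 2)"
    by (simp add: powr_add[symmetric])
  have e2: "N powr (p - 4) = N powr (p - 2) / N\<^sup>2"
    using N powr_diff[of N "p - 2" 2] by (simp add: powr_numeral)
  have "Delta_pq p q g x = N powr (q - p) * (N powr (p - 2) * T + (p - 2) * N powr (p - 4) * S)"
    unfolding Delta_pq_def div[unfolded V_def, symmetric] by (simp add: G_def N_def)
  also have "\<dots> = (N powr (q - p) * N powr (p - 2)) * (T + ((p - 2) / N\<^sup>2) * S)"
    unfolding e2 by (simp add: field_simps)
  also have "\<dots> = F_pq p q (grad g x) (hess g x)"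
    unfolding e1 F_pq_def G_def[symmetric] tr by (simp add: N_def)
  finally show ?thesis .
qed

text \<open>For \<open>\<phi>\<close> on space-time, the gradient and \<open>\<Delta>\<^sub>p\<^sup>q\<close> act on the
  time slice \<open>\<lambda>y. \<phi> (y, t)\<close>.\<close>

definition grad_x :: "((real^'n) \<times> real \<Rightarrow> real) \<Rightarrow> (real^'n) \<times> real \<Rightarrow> real^'n" where
  "grad_x \<phi> \<xi> = grad (\<lambda>y. \<phi> (y, snd \<xi>)) (fst \<xi>)"

definition Delta_pq_x ::
  "real \<Rightarrow> real \<Rightarrow> ((real^'n) \<times> real \<Rightarrow> real) \<Rightarrow> (real^'n) \<times> real \<Rightarrow> real" where
  "Delta_pq_x p q \<phi> \<xi> = Delta_pq p q (\<lambda>y. \<phi> (y, snd \<xi>)) (fst \<xi>)"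

definition deriv_t :: "((real^'n) \<times> real \<Rightarrow> real) \<Rightarrow> (real^'n) \<times> real \<Rightarrow> real" where
  "deriv_t \<phi> \<xi> = deriv (\<lambda>s. \<phi> (fst \<xi>, s)) (snd \<xi>)"

text \<open>Only used for open \<open>S\<close>.\<close>

definition C2_on :: "'a::euclidean_space set \<Rightarrow> ('a \<Rightarrow> real) \<Rightarrow> bool" where
  "C2_on S \<phi> \<longleftrightarrow>
     (\<exists>(D :: 'a \<Rightarrow> 'a \<Rightarrow>\<^sub>L real) (D2 :: 'a \<Rightarrow> 'a \<Rightarrow>\<^sub>L 'a \<Rightarrow>\<^sub>L real).
        (\<forall>\<xi>\<in>S. (\<phi> has_derivative blinfun_apply (D \<xi>)) (at \<xi>)) \<and>
        (\<forall>\<xi>\<in>S. (D has_derivative blinfun_apply (D2 \<xi>)) (at \<xi>)) \<and>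
        continuous_on S D2)"

text \<open>The derivatives \<open>f1\<close>, \<open>f2\<close> of \<open>f\<close> are one-sided at \<open>0\<close>.\<close>

definition radial_class :: "(real^'n \<Rightarrow> real^'n^'n \<Rightarrow> real) \<Rightarrow> (real \<Rightarrow> real) set" where
  "radial_class F = {f.
     (\<exists>f1 f2. (\<forall>r\<ge>0. (f has_real_derivative f1 r) (at r within {0..})) \<and>
              (\<forall>r\<ge>0. (f1 has_real_derivative f2 r) (at r within {0..})) \<and>
              continuous_on {0..} f2 \<and>
              f 0 = 0 \<and> f1 0 = 0 \<and> f2 0 = 0 \<and> (\<forall>r>0. f2 r > 0)) \<and>
     ((\<lambda>x. F (grad (\<lambda>y. f (norm y)) x) (hess (\<lambda>y. f (norm y)) x)) \<longlongrightarrow> 0) (at 0)}"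

definition Sigma_class :: "(real \<Rightarrow> real) set" where
  "Sigma_class = {\<sigma>. \<sigma> C1_differentiable_on UNIV \<and> (\<forall>r. \<sigma> (- r) = \<sigma> r) \<and>
     \<sigma> 0 = 0 \<and> deriv \<sigma> 0 = 0 \<and> (\<forall>r>0. \<sigma> r > 0)}"

text \<open>Test functions live on \<open>\<Theta>\<close> only, so the cylinder is required to lie in \<open>\<Theta>\<close>; as \<open>\<delta>\<close> may be
  decreased and \<open>\<Theta>\<close> is open, this is no restriction.\<close>

definition admissible_at ::
  "real \<Rightarrow> real \<Rightarrow> ((real^'n) \<times> real) set \<Rightarrow> ((real^'n) \<times> real \<Rightarrow> real) \<Rightarrow> (real^'n) \<times> real \<Rightarrow> bool" where
  "admissible_at p q \<Theta> \<phi> \<xi> \<longleftrightarrow>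
     grad_x \<phi> \<xi> \<noteq> 0 \<or>
     (\<exists>\<delta>>0. \<exists>f \<in> radial_class (F_pq p q :: real^'n \<Rightarrow> real^'n^'n \<Rightarrow> real). \<exists>\<sigma> \<in> Sigma_class.
        ball (fst \<xi>) \<delta> \<times> {snd \<xi> - \<delta> <..< snd \<xi> + \<delta>} \<subseteq> \<Theta> \<and>
        (\<forall>x \<in> ball (fst \<xi>) \<delta>. \<forall>t \<in> {snd \<xi> - \<delta> <..< snd \<xi> + \<delta>}.
           \<bar>\<phi> (x, t) - \<phi> \<xi> - deriv_t \<phi> \<xi> * (t - snd \<xi>)\<bar>
             \<le> f (norm (x - fst \<xi>)) + \<sigma> (t - snd \<xi>)))"

definition lsc_on :: "'a::topological_space set \<Rightarrow> ('a \<Rightarrow> ereal) \<Rightarrow> bool" where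
  "lsc_on S u \<longleftrightarrow> (\<forall>\<xi>\<in>S. u \<xi> \<le> Liminf (at \<xi> within S) u)"

definition touches_below ::
  "'a::topological_space set \<Rightarrow> ('a \<Rightarrow> real) \<Rightarrow> ('a \<Rightarrow> ereal) \<Rightarrow> 'a \<Rightarrow> bool" where
  "touches_below \<Theta> \<phi> u \<xi> \<longleftrightarrow>
     ereal (\<phi> \<xi>) = u \<xi> \<and> (\<forall>\<^sub>F \<eta> in at \<xi> within \<Theta>. ereal (\<phi> \<eta>) < u \<eta>)"

text \<open>Functions \<open>\<Theta> \<rightarrow> \<real> \<union> {\<infinity>}\<close> are modelled as total \<open>ereal\<close>-valued functions that
  avoid \<open>-\<infinity>\<close> on \<open>\<Theta>\<close>; values outside \<open>\<Theta>\<close> are irrelevant.\<close>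

definition viscosity_supersol ::
  "real \<Rightarrow> real \<Rightarrow> ((real^'n) \<times> real) set \<Rightarrow> ((real^'n) \<times> real \<Rightarrow> ereal) \<Rightarrow> bool" where
  "viscosity_supersol p q \<Theta> u \<longleftrightarrow>
     (\<forall>\<xi>\<in>\<Theta>. u \<xi> \<noteq> -\<infinity>) \<and>
     lsc_on \<Theta> u \<and>
     \<Theta> \<subseteq> closure {\<xi>\<in>\<Theta>. \<bar>u \<xi>\<bar> \<noteq> \<infinity>} \<and>
     (\<forall>\<phi>. \<forall>\<xi>\<in>\<Theta>. C2_on \<Theta> \<phi> \<longrightarrow> admissible_at p q \<Theta> \<phi> \<xi> \<longrightarrow> touches_below \<Theta> \<phi> u \<xi> \<longrightarrow>
        (grad_x \<phi> \<xi> \<noteq> 0 \<longrightarrow> deriv_t \<phi> \<xi> - Delta_pq_x p q \<phi> \<xi> \<ge> 0) \<and>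
        (grad_x \<phi> \<xi> = 0 \<longrightarrow> deriv_t \<phi> \<xi> \<ge> 0))"

definition upper_class ::
  "real \<Rightarrow> real \<Rightarrow> ((real^'n) \<times> real) set \<Rightarrow> ((real^'n) \<times> real \<Rightarrow> real)
     \<Rightarrow> ((real^'n) \<times> real \<Rightarrow> ereal) set" where
  "upper_class p q \<Theta> f = {u. viscosity_supersol p q \<Theta> u \<and>
     (\<exists>m::real. \<forall>\<xi>\<in>\<Theta>. ereal m \<le> u \<xi>) \<and>
     (\<forall>\<xi>\<in>frontier \<Theta>. ereal (f \<xi>) \<le> Liminf (at \<xi> within \<Theta>) u)}"

definition upper_Perron ::
  "real \<Rightarrow> real \<Rightarrow> ((real^'n) \<times> real) set \<Rightarrow> ((real^'n) \<times> real \<Rightarrow> real)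
     \<Rightarrow> (real^'n) \<times> real \<Rightarrow> ereal" where
  "upper_Perron p q \<Theta> f \<xi> = (INF u \<in> upper_class p q \<Theta> f. u \<xi>)"

definition regular_boundary_point ::
  "real \<Rightarrow> real \<Rightarrow> ((real^'n) \<times> real) set \<Rightarrow> (real^'n) \<times> real \<Rightarrow> bool" where
  "regular_boundary_point p q \<Theta> \<xi>0 \<longleftrightarrow>
     \<xi>0 \<in> frontier \<Theta> \<and>
     (\<forall>f. continuous_on (frontier \<Theta>) f \<longrightarrow>
        (upper_Perron p q \<Theta> f \<longlongrightarrow> ereal (f \<xi>0)) (at \<xi>0 within \<Theta>))"

end

(* The barrier is W(x,t) = c + a |x - x0|^beta + b (t - t0) with beta > max(2, q/(q-1)). The spatial
   operator applied to a |x|^beta is a constant times a^(q-1) |x|^s with s = (beta-1)(q-1) - 1 > 0, so W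
   is a classical strict supersolution on the cylinder |x - x0| <= rho once b dominates this value at
   rho. Because s > 0, W and -W are also admissible where their gradient vanishes; the borderline power
   q/(q-1) is not. For q < 2 one fixes rho and lets a tend to infinity with b proportional to a^(q-1);
   taking W(x0,t0) small instead of 0 pays for beta > q/(q-1). For q > 2 one takes beta = q and
   lets rho tend to 0 with a rho^q fixed and b proportional to rho^(-l), which needs l > q.

   Capping W by a constant gives a member of the upper class. For the lower bound no comparison principle
   between general sub- and supersolutions is needed: at an interior minimum point of u - v, with v a
   strict classical subsolution, v itself (made a strict minimum by subtracting
   |x - x1|^beta + |t - t1|^beta) is an admissible test function. *)
theory Submission
  imports Defs
begin

section \<open>Powers of the norm\<close>

text \<open>At \<open>beta = q/(q-1)\<close> the exponent s is 0: the operator applied to |x|^beta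
  is then a positive constant off the origin, while the radial class demands the limit 0. A larger
  \<open>beta\<close> makes a |x|^beta too flat near the origin to absorb the wedge term b theta
  |x|^l when l = k = q/(q-1). For q < 2 this deficit is harmless: b/a is of order a^(q-2), the two
  terms cross where |x|^k is of order 1/a, and below that radius the wedge term is at most of order
  a^(q-2), which tends to 0 as a grows. The localization to a cylinder creates a lateral boundary
  inside Theta on which nothing is prescribed. From above it is bridged by making W exceed the cap
  there. From below a bound for u is needed that is common to the whole upper class, whereas
  membership only supplies a bound depending on u. A preliminary comparison on all of Theta with a
  function of t alone, which uses the individual bound only to know that an infimum is finite,
  provides the common one.\<close>

definition pnorm :: "real \<Rightarrow> 'a::real_inner \<Rightarrow> real" where
  "pnorm \<beta> x = norm x powr \<beta>"

definition pgrad :: "real \<Rightarrow> 'a::real_inner \<Rightarrow> 'a" where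
  "pgrad \<beta> x = (\<beta> * norm x powr (\<beta> - 2)) *\<^sub>R x"

text \<open>Gradient and Hessian of |x|^beta in closed form, over any inner product space so that
  they serve both in x and in t. The exponents may be negative, but \<open>0 powr e = 0\<close>
  makes the formulas vanish at the origin, which is the true value for
  \<open>beta > 2\<close>.\<close>

definition phess :: "real \<Rightarrow> 'a::real_inner \<Rightarrow> 'a \<Rightarrow> 'a" where
  "phess \<beta> x h = (\<beta> * norm x powr (\<beta> - 2)) *\<^sub>R h
     + (\<beta> * (\<beta> - 2) * norm x powr (\<beta> - 4) * (x \<bullet> h)) *\<^sub>R x"

lemma pnorm_0 [simp]: "pnorm \<beta> 0 = 0"
  and pgrad_0 [simp]: "pgrad \<beta> 0 = 0"
  and phess_0 [simp]: "phess \<beta> 0 h = 0"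
  by (simp_all add: pnorm_def pgrad_def phess_def)

lemma pnorm_nonneg [simp]: "pnorm \<beta> x \<ge> 0"
  by (simp add: pnorm_def)

lemma has_derivative_norm_powr:
  fixes x :: "'a::real_inner"
  assumes "x \<noteq> 0"
  shows "((\<lambda>y. norm y powr \<gamma>) has_derivative (\<lambda>h. \<gamma> * norm x powr (\<gamma> - 2) * (x \<bullet> h))) (at x)"
proof -
  have nd: "(norm has_derivative (\<lambda>h. sgn x \<bullet> h)) (at x)"
    using has_derivative_norm[of x] assms by (simp add: inner_commute)
  have "((\<lambda>z. z powr \<gamma>) has_real_derivative \<gamma> * norm x powr (\<gamma> - 1)) (at (norm x))"
    using assms by (intro has_real_derivative_powr) simp
  then have "((\<lambda>z. z powr \<gamma>) has_derivative (\<lambda>h. \<gamma> * norm x powr (\<gamma> - 1) * h)) (at (norm x))"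
    by (simp add: has_field_derivative_def)
  from has_derivative_compose[OF nd this]
  have *: "((\<lambda>y. norm y powr \<gamma>) has_derivative
      (\<lambda>h. \<gamma> * norm x powr (\<gamma> - 1) * (sgn x \<bullet> h))) (at x)" .
  have "norm x powr (\<gamma> - 1) = norm x powr (\<gamma> - 2) * norm x"
    using assms powr_add[of "norm x" "\<gamma> - 2" 1] by simp
  then have "\<gamma> * norm x powr (\<gamma> - 1) * (sgn x \<bullet> h) = \<gamma> * norm x powr (\<gamma> - 2) * (x \<bullet> h)" for h
    using assms by (simp add: sgn_div_norm)
  with * show ?thesis by simp
qed

text \<open>Covers the origin, where the differentiation rule for real powers does not
  apply.\<close>

lemma has_derivative_zero_at_0:
  fixes f :: "'a::real_normed_vector \<Rightarrow> 'b::real_normed_vector"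
  assumes "f 0 = 0" and "\<And>y. norm (f y) \<le> c * norm y powr \<gamma>" and "\<gamma> > 1"
  shows "(f has_derivative (\<lambda>h. 0)) (at 0)"
proof -
  have "((\<lambda>h. c * norm h powr (\<gamma> - 1)) \<longlongrightarrow> c * norm (0::'a) powr (\<gamma> - 1)) (at 0)"
    using assms(3) by (intro tendsto_intros) (auto intro!: tendsto_norm_zero)
  then have lim: "((\<lambda>h::'a. c * norm h powr (\<gamma> - 1)) \<longlongrightarrow> 0) (at 0)" by simp
  have bd: "norm (norm (f (0 + h) - f 0 - 0) / norm h) \<le> c * norm h powr (\<gamma> - 1)" if "h \<noteq> 0" for h
  proof -
    have "norm (f h) / norm h \<le> c * norm h powr \<gamma> / norm h"
      by (rule divide_right_mono[OF assms(2)]) simp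
    also have "\<dots> = c * norm h powr (\<gamma> - 1)"
      using that by (simp add: powr_diff)
    finally show ?thesis using assms(1) by simp
  qed
  have "((\<lambda>h. norm (f (0 + h) - f 0 - 0) / norm h) \<longlongrightarrow> 0) (at 0)"
    by (rule Lim_null_comparison[OF _ lim]) (use bd in \<open>auto simp: eventually_at_filter intro!: always_eventually\<close>)
  then show ?thesis
    unfolding has_derivative_at by (simp add: bounded_linear_zero)
qed

lemma GDERIV_pnorm:
  fixes x :: "'a::real_inner"
  assumes "\<beta> > 2"
  shows "GDERIV (pnorm \<beta>) x :> pgrad \<beta> x"
proof (cases "x = 0")
  case True
  have "(pnorm \<beta> has_derivative (\<lambda>h::'a. 0)) (at 0)"
    by (rule has_derivative_zero_at_0[where c = 1 and \<gamma> = \<beta>]) (use assms in \<open>auto simp: pnorm_def\<close>)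
  then show ?thesis using True by (simp add: gderiv_def)
next
  case False
  from has_derivative_norm_powr[OF this, of \<beta>] show ?thesis
    by (simp add: gderiv_def pnorm_def[abs_def] pgrad_def inner_commute)
qed

lemma pgrad_has_derivative:
  fixes x :: "'a::real_inner"
  assumes "\<beta> > 2"
  shows "(pgrad \<beta> has_derivative phess \<beta> x) (at x)"
proof (cases "x = 0")
  case True
  have "norm (pgrad \<beta> y) = \<beta> * norm y powr (\<beta> - 1)" for y :: 'a
    using assms powr_mult_base[of "norm y" "\<beta> - 2"] by (simp add: pgrad_def mult.commute)
  then have "(pgrad \<beta> has_derivative (\<lambda>h::'a. 0)) (at 0)"
    by (intro has_derivative_zero_at_0[where c = \<beta> and \<gamma> = "\<beta> - 1"]) (use assms in auto)
  moreover have "phess \<beta> x = (\<lambda>h. 0)" using True by (simp add: fun_eq_iff)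
  ultimately show ?thesis using True by simp
next
  case False
  have "((\<lambda>y. (\<beta> * norm y powr (\<beta> - 2)) *\<^sub>R y) has_derivative
     (\<lambda>h. (\<beta> * norm x powr (\<beta> - 2)) *\<^sub>R h
       + (\<beta> * ((\<beta> - 2) * norm x powr (\<beta> - 2 - 2) * (x \<bullet> h))) *\<^sub>R x)) (at x)"
    by (intro has_derivative_scaleR has_derivative_mult_right has_derivative_norm_powr[OF False]
        has_derivative_ident)
  then show ?thesis
    by (simp add: pgrad_def[abs_def] phess_def[abs_def] mult.assoc)
qed

lemma continuous_on_phess:
  assumes "\<beta> > 2"
  shows "continuous_on UNIV (\<lambda>x::'a::real_inner. phess \<beta> x h)"
proof -
  have "isCont (\<lambda>x. phess \<beta> x h) x" for x :: 'a
  proof (cases "x = 0")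
    case False
    then show ?thesis unfolding phess_def by (intro continuous_intros) auto
  next
    case True
    have "((\<lambda>y. \<beta> * (\<beta> - 1) * norm y powr (\<beta> - 2) * norm h) \<longlongrightarrow>
        \<beta> * (\<beta> - 1) * norm (0::'a) powr (\<beta> - 2) * norm h) (at 0)"
      using assms by (intro tendsto_intros) (auto intro!: tendsto_norm_zero)
    then have lim: "((\<lambda>y::'a. \<beta> * (\<beta> - 1) * norm y powr (\<beta> - 2) * norm h) \<longlongrightarrow> 0) (at 0)"
      by simp
    \<comment> \<open>Both summands are of size |y|^(beta-2) |h|, with coefficients beta and beta
      (beta-2), which add up to beta (beta-1).\<close>
    have bd: "norm (phess \<beta> y h) \<le> \<beta> * (\<beta> - 1) * norm y powr (\<beta> - 2) * norm h" for y :: 'a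
    proof (cases "y = 0")
      case False
      have e: "norm y powr (\<beta> - 2) = norm y powr (\<beta> - 4) * (norm y * norm y)"
        using False powr_add[of "norm y" "\<beta> - 4" 2] by (simp add: powr_numeral power2_eq_square)
      have "norm (phess \<beta> y h) \<le> \<beta> * norm y powr (\<beta> - 2) * norm h
          + \<beta> * (\<beta> - 2) * norm y powr (\<beta> - 4) * \<bar>y \<bullet> h\<bar> * norm y"
        unfolding phess_def using assms by (intro norm_triangle_le) (simp add: abs_mult)
      also have "\<dots> \<le> \<beta> * norm y powr (\<beta> - 2) * norm h
          + \<beta> * (\<beta> - 2) * norm y powr (\<beta> - 4) * (norm y * norm h) * norm y"
        using assms Cauchy_Schwarz_ineq2[of y h]
        by (intro add_left_mono mult_right_mono mult_left_mono) auto
      also have "\<dots> = \<beta> * (\<beta> - 1) * norm y powr (\<beta> - 2) * norm h"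
        unfolding e by (simp add: algebra_simps)
      finally show ?thesis .
    qed (use assms in simp)
    have "((\<lambda>y. phess \<beta> y h) \<longlongrightarrow> 0) (at 0)"
      by (rule Lim_null_comparison[OF always_eventually lim]) (use bd in auto)
    then show ?thesis using True by (simp add: isCont_def)
  qed
  then show ?thesis by (simp add: continuous_on_eq_continuous_at)
qed

text \<open>Translates gradient fields into the bounded linear maps of \<open>C2_on\<close> by the
  Riesz representation. Continuity in each fixed direction suffices because the dimension is
  finite.\<close>

lemma C2_onI_gderiv:
  fixes g :: "'a::euclidean_space \<Rightarrow> real"
  assumes g: "\<And>x. x \<in> S \<Longrightarrow> GDERIV g x :> G x"
    and G: "\<And>x. x \<in> S \<Longrightarrow> (G has_derivative G' x) (at x)"
    and c: "\<And>h. continuous_on S (\<lambda>x. G' x h)"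
  shows "C2_on S g"
proof -
  define D where "D = (\<lambda>x. blinfun_inner_right (G x))"
  define D2 where "D2 = (\<lambda>x. Blinfun (\<lambda>h. blinfun_inner_right (G' x h)))"
  have bl: "bounded_linear (\<lambda>h. blinfun_inner_right (G' x h))" if "x \<in> S" for x
    using bounded_linear_compose[OF bounded_linear_blinfun_inner_right
        has_derivative_bounded_linear[OF G[OF that]]] .
  have D2: "blinfun_apply (D2 x) = (\<lambda>h. blinfun_inner_right (G' x h))" if "x \<in> S" for x
    unfolding D2_def using bl[OF that] by (rule bounded_linear_Blinfun_apply)
  have 1: "(g has_derivative blinfun_apply (D x)) (at x)" if "x \<in> S" for x
    using g[OF that] by (simp add: D_def gderiv_def inner_commute[of _ "G x"])
  have 2: "(D has_derivative blinfun_apply (D2 x)) (at x)" if "x \<in> S" for x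
    unfolding D2[OF that] D_def
    by (rule bounded_linear.has_derivative[OF bounded_linear_blinfun_inner_right G[OF that]])
  have 3: "continuous_on S D2"
  proof (rule continuous_on_blinfun_componentwise)
    fix i :: 'a assume "i \<in> Basis"
    have "continuous_on S (\<lambda>x. blinfun_inner_right (G' x i))"
      by (rule bounded_linear.continuous_on[OF bounded_linear_blinfun_inner_right c])
    then show "continuous_on S (\<lambda>x. blinfun_apply (D2 x) i)"
      by (rule continuous_on_eq) (simp add: D2)
  qed
  show ?thesis unfolding C2_on_def using 1 2 3 by blast
qed

section \<open>Second-order data and ellipticity\<close>

text \<open>A gradient field near \<open>x\<close> is part of the data because the Hessian is the
  derivative of that field. Differentiability of the field is asked at \<open>x\<close> alone, and
  symmetry of \<open>H\<close> is not part of the notion.\<close>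

definition has_jet :: "('a::real_inner \<Rightarrow> real) \<Rightarrow> 'a \<Rightarrow> 'a \<Rightarrow> ('a \<Rightarrow> 'a) \<Rightarrow> bool" where
  "has_jet g x \<eta> H \<longleftrightarrow>
     (\<exists>G. (\<forall>\<^sub>F y in nhds x. GDERIV g y :> G y) \<and> G x = \<eta> \<and> (G has_derivative H) (at x))"

lemma grad_eqI:
  assumes "GDERIV g x :> d"
  shows "grad g x = d"
  unfolding grad_def
proof (rule the_equality[where P = "\<lambda>D. GDERIV g x :> D", OF assms])
  fix e assume "GDERIV g x :> e"
  then have "(\<lambda>h. h \<bullet> e) = (\<lambda>h. h \<bullet> d)"
    using assms unfolding gderiv_def by (rule has_derivative_unique)
  then have "h \<bullet> e = h \<bullet> d" for h by (rule fun_cong)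
  then show "e = d" using vector_eq_rdot[of e d] by (simp add: inner_commute)
qed

lemma has_jet_linear:
  assumes "has_jet g x \<eta> H" shows "linear H"
  using assms unfolding has_jet_def by (auto dest: has_derivative_linear)

lemma has_jet_grad:
  assumes "has_jet g x \<eta> H"
  shows "grad g x = \<eta>" and "(grad g has_derivative H) (at x)"
proof -
  obtain G where G: "\<forall>\<^sub>F y in nhds x. GDERIV g y :> G y" "G x = \<eta>" "(G has_derivative H) (at x)"
    using assms unfolding has_jet_def by blast
  have ev: "\<forall>\<^sub>F y in nhds x. G y = grad g y"
    using G(1) by (rule eventually_mono) (simp add: grad_eqI)
  show "grad g x = \<eta>" using eventually_nhds_x_imp_x[OF ev] G(2) by simp
  show "(grad g has_derivative H) (at x)"
    using G(3) eventually_nhds_conv_at[THEN iffD1, OF ev]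
    by (intro has_derivative_transform_eventually[OF G(3)]) auto
qed

lemma has_jet_diff:
  assumes "has_jet g x \<eta> H" and "has_jet g' x \<eta>' H'"
  shows "has_jet (\<lambda>y. g y - g' y) x (\<eta> - \<eta>') (\<lambda>h. H h - H' h)"
proof -
  obtain G where G: "\<forall>\<^sub>F y in nhds x. GDERIV g y :> G y" "G x = \<eta>" "(G has_derivative H) (at x)"
    using assms(1) unfolding has_jet_def by blast
  obtain G' where G': "\<forall>\<^sub>F y in nhds x. GDERIV g' y :> G' y" "G' x = \<eta>'" "(G' has_derivative H') (at x)"
    using assms(2) unfolding has_jet_def by blast
  have "\<forall>\<^sub>F y in nhds x. GDERIV (\<lambda>y. g y - g' y) y :> G y - G' y"
    using eventually_conj[OF G(1) G'(1)] by (rule eventually_mono) (auto intro: GDERIV_diff)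
  then show ?thesis
    unfolding has_jet_def using G(2) G'(2) has_derivative_diff[OF G(3) G'(3)]
    by (intro exI[of _ "\<lambda>y. G y - G' y"]) auto
qed

text \<open>The gradient field is differentiable only at \<open>x\<close>, so the argument runs
  along a line instead of through a second-order Taylor formula: if
  \<open>v \<bullet> H v < 0\<close>, the directional derivative \<open>k\<close> vanishes at 0 and
  is negative just after it, and the mean value theorem produces a value of \<open>g\<close> below
  \<open>g x\<close>.\<close>

lemma has_jet_local_min:
  assumes jet: "has_jet g x \<eta> H" and min: "\<forall>\<^sub>F y in nhds x. g x \<le> g y"
  shows "\<eta> = 0" and "v \<bullet> H v \<ge> 0"
proof -
  obtain G where G: "\<forall>\<^sub>F y in nhds x. GDERIV g y :> G y" "G x = \<eta>" "(G has_derivative H) (at x)"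
    using jet unfolding has_jet_def by blast
  obtain d where d: "d > 0" "\<And>y. dist y x < d \<Longrightarrow> GDERIV g y :> G y \<and> g x \<le> g y"
    using eventually_conj[OF G(1) min] unfolding eventually_nhds_metric by blast
  have "(g has_derivative (\<lambda>h. h \<bullet> G x)) (at x)"
    using d(2)[of x] d(1) by (simp add: gderiv_def)
  then have "(\<lambda>h. h \<bullet> G x) = (\<lambda>h. 0)"
    using min by (intro has_derivative_local_min) (auto simp: eventually_at_filter elim: eventually_mono)
  then have "G x \<bullet> G x = 0" by (rule fun_cong)
  then show \<eta>: "\<eta> = 0" using G(2) by simp
  show "v \<bullet> H v \<ge> 0"
  proof (cases "v = 0")
    case True
    then show ?thesis by simp
  next
    case False
    show ?thesis
    proof (rule ccontr)
      assume neg: "\<not> v \<bullet> H v \<ge> 0"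
      define k where "k = (\<lambda>s::real. v \<bullet> G (x + s *\<^sub>R v))"
      have lin: "((\<lambda>s::real. x + s *\<^sub>R v) has_derivative (\<lambda>s. s *\<^sub>R v)) (at s)" for s
        by (auto intro!: derivative_eq_intros)
      have "((\<lambda>s. G (x + s *\<^sub>R v)) has_derivative (\<lambda>s. H (s *\<^sub>R v))) (at 0)"
        using has_derivative_compose[OF lin[of 0], of G H] G(3) by simp
      then have "(k has_derivative (\<lambda>s. v \<bullet> H (s *\<^sub>R v))) (at 0)"
        unfolding k_def by (rule has_derivative_inner_right)
      moreover have "(\<lambda>s. v \<bullet> H (s *\<^sub>R v)) = (*) (v \<bullet> H v)"
        using has_jet_linear[OF jet] by (simp add: fun_eq_iff linear_cmul)
      ultimately have "(k has_real_derivative (v \<bullet> H v)) (at 0)"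
        by (simp add: has_field_derivative_def)
      from DERIV_neg_dec_right[OF this] neg obtain e where
        e: "e > 0" "\<And>s. 0 < s \<Longrightarrow> s < e \<Longrightarrow> k s < k 0" by auto
      have k0: "k 0 = 0" using \<eta> G(2) by (simp add: k_def)
      define s where "s = min (e / 2) (d / (2 * norm v))"
      have s: "s > 0" "s < e" "s * norm v < d"
      proof -
        show "s > 0" "s < e" using e(1) d(1) False by (auto simp: s_def)
        have "s * norm v \<le> d / (2 * norm v) * norm v"
          by (intro mult_right_mono) (auto simp: s_def)
        then show "s * norm v < d" using d(1) False by simp
      qed
      have in_ball: "dist (x + z *\<^sub>R v) x < d" if "0 \<le> z" "z \<le> s" for z
        using that s mult_right_mono[of z s "norm v"] by (simp add: dist_norm)
      have der: "((\<lambda>s. g (x + s *\<^sub>R v)) has_real_derivative k z) (at z)" if "0 \<le> z" "z \<le> s" for z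
      proof -
        have "(g has_derivative (\<lambda>h. h \<bullet> G (x + z *\<^sub>R v))) (at (x + z *\<^sub>R v))"
          using d(2)[OF in_ball[OF that]] by (simp add: gderiv_def)
        from has_derivative_compose[OF lin this]
        show ?thesis by (simp add: has_field_derivative_def k_def mult_commute_abs)
      qed
      obtain z where z: "0 < z" "z < s" "g (x + s *\<^sub>R v) - g (x + 0 *\<^sub>R v) = (s - 0) * k z"
        using MVT2[of 0 s "\<lambda>s. g (x + s *\<^sub>R v)" k] der s(1) by auto
      have "k z < 0" using e(2)[of z] z s k0 by simp
      then have "g (x + s *\<^sub>R v) < g x" using z(3) s(1) by (simp add: mult_less_0_iff algebra_simps)
      moreover have "g x \<le> g (x + s *\<^sub>R v)" using d(2)[OF in_ball[of s]] s by simp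
      ultimately show False by simp
    qed
  qed
qed

text \<open>The normalized p-Laplacian, that is F without its factor |eta|^(q-2), written for a
  linear map in place of a matrix. It is linear in \<open>H\<close> once \<open>\<eta>\<close> is
  fixed.\<close>

definition quasi_trace :: "real \<Rightarrow> real^'n \<Rightarrow> (real^'n \<Rightarrow> real^'n) \<Rightarrow> real" where
  "quasi_trace p \<eta> H = (\<Sum>i\<in>UNIV. H (axis i 1) $ i) + (p - 2) / (norm \<eta>)\<^sup>2 * (\<eta> \<bullet> H \<eta>)"

lemma linear_expansion:
  fixes H :: "real^'n \<Rightarrow> real^'n"
  assumes "linear H"
  shows "(\<Sum>i\<in>UNIV. (v $ i) *\<^sub>R H (axis i 1)) = H v"
proof -
  have "H v = H (\<Sum>i\<in>UNIV. (v $ i) *\<^sub>R axis i 1)"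
    using basis_expansion[of v] by (simp add: scalar_mult_eq_scaleR)
  also have "\<dots> = (\<Sum>i\<in>UNIV. (v $ i) *\<^sub>R H (axis i 1))"
    using assms by (simp add: linear_sum linear_cmul)
  finally show ?thesis by simp
qed

lemma F_pq_matrix:
  fixes H :: "real^'n \<Rightarrow> real^'n"
  assumes "linear H"
  shows "F_pq p q \<eta> (matrix H) = norm \<eta> powr (q - 2) * quasi_trace p \<eta> H"
proof -
  have "\<eta> \<bullet> H \<eta> = (\<Sum>i\<in>UNIV. \<eta> $ i * (\<eta> \<bullet> H (axis i 1)))"
    unfolding linear_expansion[OF assms, of \<eta>, symmetric] by (simp add: inner_sum_right)
  then have *: "\<eta> \<bullet> H \<eta> = (\<Sum>i\<in>UNIV. \<Sum>j\<in>UNIV. \<eta> $ i * (\<eta> $ j * H (axis i 1) $ j))"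
    by (simp add: inner_vec_def sum_distrib_left)
  show ?thesis
    unfolding F_pq_def quasi_trace_def *
    by (simp add: trace_def matrix_def tensor_def matrix_matrix_mult_def
          sum.distrib sum_distrib_left sum_distrib_right mult_ac)
qed

lemma Delta_pq_jet:
  fixes g :: "real^'n \<Rightarrow> real"
  assumes jet: "has_jet g x \<eta> H" and "\<eta> \<noteq> 0"
  shows "Delta_pq p q g x = norm \<eta> powr (q - 2) * quasi_trace p \<eta> H"
proof -
  note G = has_jet_grad[OF jet]
  have "hess g x = matrix H"
    by (simp add: hess_def jacobian_def frechet_derivative_at[OF G(2), symmetric])
  then show ?thesis
    using Delta_pq_eq_F_pq[of g x p q] G assms(2)
    by (auto simp: F_pq_matrix[OF has_jet_linear[OF jet]] differentiable_def)
qed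

text \<open>Degenerate ellipticity. Since \<open>H\<close> need not be symmetric there is no
  eigenbasis to work in; the quasi-trace is instead exhibited as a sum of values of the quadratic
  form, and \<open>p > 1\<close> is what makes the required coefficient real.\<close>

lemma quasi_trace_nonneg:
  fixes H :: "real^'n \<Rightarrow> real^'n"
  assumes "linear H" and pos: "\<And>v. v \<bullet> H v \<ge> 0" and "p > 1" and "\<eta> \<noteq> 0"
  shows "quasi_trace p \<eta> H \<ge> 0"
proof -
  define e where "e = \<eta> /\<^sub>R norm \<eta>"
  \<comment> \<open>\<open>k\<close> solves \<open>k\<^sup>2 - 2 k = p - 2\<close>, so that summing the quadratic form of \<open>H\<close> over the vectors
    \<open>e\<^sub>i - k (e \<bullet> e\<^sub>i) e\<close> gives exactly the quasi-trace.\<close>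
  define k where "k = 1 + sqrt (p - 1)"
  have k: "k * k - 2 * k = p - 2"
    using assms(3) by (simp add: k_def algebra_simps)
  have e1: "e \<bullet> e = 1" using assms(4) by (simp add: e_def dot_square_norm power2_eq_square)
  have eHe: "e \<bullet> H e = (\<eta> \<bullet> H \<eta>) / (norm \<eta>)\<^sup>2"
    using assms(1) by (simp add: e_def linear_cmul power2_eq_square divide_inverse)
  have S1: "(\<Sum>i\<in>UNIV. e $ i * (e \<bullet> H (axis i 1))) = e \<bullet> H e"
    unfolding linear_expansion[OF assms(1), of e, symmetric] by (simp add: inner_sum_right)
  have S2: "(\<Sum>i\<in>UNIV. e $ i * H e $ i) = e \<bullet> H e"
    by (simp add: inner_vec_def)
  have S3: "(\<Sum>i\<in>UNIV. e $ i * e $ i) = 1"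
    using e1 by (simp add: inner_vec_def)
  have "0 \<le> (\<Sum>i\<in>UNIV. (axis i 1 - (k * e $ i) *\<^sub>R e) \<bullet> H (axis i 1 - (k * e $ i) *\<^sub>R e))"
    by (intro sum_nonneg pos)
  also have "\<dots> = (\<Sum>i\<in>UNIV. H (axis i 1) $ i - k * (e $ i * (e \<bullet> H (axis i 1)))
       - k * (e $ i * H e $ i) + k * k * ((e $ i * e $ i) * (e \<bullet> H e)))"
    using assms(1)
    by (intro sum.cong refl)
      (simp add: linear_diff linear_cmul inner_diff_left inner_diff_right inner_axis' algebra_simps)
  also have "\<dots> = (\<Sum>i\<in>UNIV. H (axis i 1) $ i) + (k * k - 2 * k) * (e \<bullet> H e)"
    unfolding sum.distrib sum_subtractf sum_distrib_left[symmetric] sum_distrib_right[symmetric] S1 S2 S3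
    by (simp add: algebra_simps)
  also have "\<dots> = quasi_trace p \<eta> H"
    unfolding k eHe quasi_trace_def by simp
  finally show ?thesis .
qed

text \<open>The difference \<open>\<psi> - \<phi>\<close> has a local minimum at \<open>x\<close>,
  so the gradients agree there and the difference of the Hessians is nonnegative; ellipticity and
  linearity of \<open>quasi_trace\<close> in \<open>H\<close> do the rest.\<close>

lemma Delta_pq_mono:
  fixes \<phi> \<psi> :: "real^'n \<Rightarrow> real"
  assumes "p > 1" and jet: "has_jet \<phi> x \<eta> H" "has_jet \<psi> x \<eta>' H'"
    and le: "\<forall>\<^sub>F y in nhds x. \<phi> y \<le> \<psi> y" and eq: "\<phi> x = \<psi> x"
  shows "\<eta> = \<eta>'" and "\<eta> \<noteq> 0 \<Longrightarrow> Delta_pq p q \<phi> x \<le> Delta_pq p q \<psi> x"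
proof -
  note jd = has_jet_diff[OF jet(2) jet(1)]
  have ev: "\<forall>\<^sub>F y in nhds x. \<psi> x - \<phi> x \<le> \<psi> y - \<phi> y"
    using le eq by simp
  show \<eta>: "\<eta> = \<eta>'" using has_jet_local_min(1)[OF jd ev] by simp
  assume nz: "\<eta> \<noteq> 0"
  have "quasi_trace p \<eta> (\<lambda>h. H' h - H h) \<ge> 0"
    using quasi_trace_nonneg[OF has_jet_linear[OF jd] has_jet_local_min(2)[OF jd ev] assms(1) nz] .
  then have "quasi_trace p \<eta> H \<le> quasi_trace p \<eta> H'"
    by (simp add: quasi_trace_def sum_subtractf inner_diff_right right_diff_distrib del: times_divide_eq_left)
  then show "Delta_pq p q \<phi> x \<le> Delta_pq p q \<psi> x"
    using Delta_pq_jet[OF jet(1) nz] Delta_pq_jet[OF jet(2)] nz \<eta> by (simp add: mult_left_mono)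
qed

text \<open>Supplies an arbitrary space-time test function with the spatial jet that
  \<open>Delta_pq_mono\<close> asks for. The gradient is read off by applying the full derivative to
  the vectors \<open>(b, 0)\<close>.\<close>

lemma C2_on_slice:
  fixes \<phi> :: "'a::euclidean_space \<times> real \<Rightarrow> real"
  assumes "C2_on \<Theta> \<phi>" and "open \<Theta>" and "(x, t) \<in> \<Theta>"
  shows "\<exists>\<eta> H. has_jet (\<lambda>y. \<phi> (y, t)) x \<eta> H"
    and "(\<lambda>s. \<phi> (x, s)) differentiable at t"
proof -
  obtain D D2 where D: "\<And>\<xi>. \<xi> \<in> \<Theta> \<Longrightarrow> (\<phi> has_derivative blinfun_apply (D \<xi>)) (at \<xi>)"
    and D2: "\<And>\<xi>. \<xi> \<in> \<Theta> \<Longrightarrow> (D has_derivative blinfun_apply (D2 \<xi>)) (at \<xi>)"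
    using assms(1) unfolding C2_on_def by blast
  have p1: "((\<lambda>y. (y, t)) has_derivative (\<lambda>h. (h, 0))) (at y)" for y :: 'a
    by (auto intro!: derivative_eq_intros)
  have p2: "((\<lambda>s. (x, s)) has_derivative (\<lambda>k. (0, k))) (at s)" for s :: real
    by (auto intro!: derivative_eq_intros)
  have "((\<lambda>s. \<phi> (x, s)) has_derivative (\<lambda>k. blinfun_apply (D (x, t)) (0, k))) (at t)"
    using has_derivative_compose[OF p2 D[OF assms(3)]] .
  then show "(\<lambda>s. \<phi> (x, s)) differentiable at t" by (auto simp: differentiable_def)
  define G where "G = (\<lambda>y. \<Sum>b\<in>Basis. blinfun_apply (D (y, t)) (b, 0) *\<^sub>R b)"
  define H where "H = (\<lambda>h. \<Sum>b\<in>Basis. blinfun_apply (blinfun_apply (D2 (x, t)) (h, 0)) (b, 0) *\<^sub>R b)"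
  have "((\<lambda>y. D (y, t)) has_derivative (\<lambda>h. blinfun_apply (D2 (x, t)) (h, 0))) (at x)"
    using has_derivative_compose[OF p1 D2[OF assms(3)]] .
  then have "(G has_derivative H) (at x)"
    unfolding G_def H_def
    by (intro has_derivative_sum has_derivative_scaleR_left
        bounded_linear.has_derivative[OF blinfun.bounded_linear_left])
  moreover have "GDERIV (\<lambda>y. \<phi> (y, t)) y :> G y" if "(y, t) \<in> \<Theta>" for y
  proof -
    have "blinfun_apply (D (y, t)) (h, 0) = h \<bullet> G y" for h
    proof -
      have "(h, 0::real) = (\<Sum>b\<in>Basis. (h \<bullet> b) *\<^sub>R (b, 0))"
        by (simp add: prod_eq_iff fst_sum snd_sum euclidean_representation)
      then have "blinfun_apply (D (y, t)) (h, 0) = blinfun_apply (D (y, t)) (\<Sum>b\<in>Basis. (h \<bullet> b) *\<^sub>R (b, 0))"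
        by simp
      also have "\<dots> = h \<bullet> G y"
        by (simp only: blinfun.sum_right blinfun.scaleR_right G_def inner_sum_right inner_scaleR_right
             real_scaleR_def mult.commute)
      finally show ?thesis .
    qed
    then show ?thesis
      using has_derivative_compose[OF p1 D[OF that]] by (simp add: gderiv_def)
  qed
  moreover have "\<forall>\<^sub>F y in nhds x. (y, t) \<in> \<Theta>"
  proof -
    have "open ((\<lambda>y. (y, t)) -` \<Theta>)"
      by (intro open_vimage assms continuous_intros)
    then show ?thesis using assms(3) by (auto simp: eventually_nhds)
  qed
  ultimately show "\<exists>\<eta> H. has_jet (\<lambda>y. \<phi> (y, t)) x \<eta> H"
    unfolding has_jet_def by (blast intro: eventually_mono)
qed

section \<open>Radial barriers and admissible test functions\<close>

lemma pnorm_has_derivative: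
  "\<beta> > 2 \<Longrightarrow> (pnorm \<beta> has_derivative (\<lambda>h. h \<bullet> pgrad \<beta> x)) (at x)"
  using GDERIV_pnorm[of \<beta> x] by (simp add: gderiv_def)

lemma has_derivative_comp_diff:
  assumes "(f has_derivative f') (at (g x - z))" and "(g has_derivative g') (at x)"
  shows "((\<lambda>y. f (g y - z)) has_derivative (\<lambda>h. f' (g' h))) (at x)"
  by (rule has_derivative_compose[of "\<lambda>y. g y - z"]) (use assms in \<open>auto intro!: derivative_eq_intros\<close>)

text \<open>Two centres, so that one statement covers a pure power, a barrier (\<open>m = 0\<close>)
  and a barrier with a penalty term around another point.\<close>

lemma has_jet_pnorm:
  assumes "\<beta> > 2"
  shows "has_jet (\<lambda>y. c + k * pnorm \<beta> (y - z) + m * pnorm \<beta> (y - w)) x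
    (k *\<^sub>R pgrad \<beta> (x - z) + m *\<^sub>R pgrad \<beta> (x - w))
    (\<lambda>h. k *\<^sub>R phess \<beta> (x - z) h + m *\<^sub>R phess \<beta> (x - w) h)"
proof -
  have "GDERIV (\<lambda>y. c + k * pnorm \<beta> (y - z) + m * pnorm \<beta> (y - w)) y :>
      k *\<^sub>R pgrad \<beta> (y - z) + m *\<^sub>R pgrad \<beta> (y - w)" for y
    unfolding gderiv_def
    by (auto intro!: derivative_eq_intros has_derivative_comp_diff pnorm_has_derivative assms
        simp: inner_add_right fun_eq_iff)
  moreover have "((\<lambda>y. k *\<^sub>R pgrad \<beta> (y - z) + m *\<^sub>R pgrad \<beta> (y - w)) has_derivative
      (\<lambda>h. k *\<^sub>R phess \<beta> (x - z) h + m *\<^sub>R phess \<beta> (x - w) h)) (at x)"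
    by (intro has_derivative_add has_derivative_scaleR_right has_derivative_comp_diff
        pgrad_has_derivative assms has_derivative_ident)
  ultimately show ?thesis
    unfolding has_jet_def by (intro exI[of _ "\<lambda>y. k *\<^sub>R pgrad \<beta> (y - z) + m *\<^sub>R pgrad \<beta> (y - w)"]) simp
qed

lemma pgrad_eq_0_iff: "\<beta> > 2 \<Longrightarrow> pgrad \<beta> x = 0 \<longleftrightarrow> x = 0"
  by (auto simp: pgrad_def)

lemma norm_pgrad: "\<beta> > 2 \<Longrightarrow> norm (pgrad \<beta> x) = \<beta> * norm x powr (\<beta> - 1)"
  using powr_mult_base[of "norm x" "\<beta> - 2"] by (simp add: pgrad_def mult.commute)

text \<open>The Hessian of |x|^beta has eigenvalue beta |x|^(beta-2) in the n - 1 tangential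
  directions and (beta-1) times that in the radial one, which the operator weights by p - 1. The
  factor |eta|^(q-2) contributes the remaining powers of beta.\<close>

definition radial_const :: "real \<Rightarrow> real \<Rightarrow> real \<Rightarrow> nat \<Rightarrow> real" where
  "radial_const p q \<beta> n = \<beta> powr (q - 1) * (real n - 1 + (p - 1) * (\<beta> - 1))"

lemma radial_const_pos:
  assumes "p > 1" "\<beta> > 2" "n > 0"
  shows "radial_const p q \<beta> n > 0"
  unfolding radial_const_def using assms by (intro mult_pos_pos add_nonneg_pos) auto

text \<open>Admitting both signs of \<open>k\<close> serves supersolutions and subsolutions at once:
  the operator is odd and homogeneous of degree q - 1. The exponent of |z| is (beta-1)(q-2) +
  (beta-2).\<close>

lemma F_pq_radial:
  fixes z :: "real^'n"
  assumes \<beta>: "\<beta> > 2" and k: "k \<noteq> 0" and z: "z \<noteq> 0"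
  shows "norm (k *\<^sub>R pgrad \<beta> z) powr (q - 2) * quasi_trace p (k *\<^sub>R pgrad \<beta> z) (\<lambda>h. k *\<^sub>R phess \<beta> z h)
    = sgn k * \<bar>k\<bar> powr (q - 1) * radial_const p q \<beta> CARD('n) * norm z powr ((\<beta> - 1) * (q - 1) - 1)"
proof -
  define N where "N = norm z"
  have N: "N > 0" using z by (simp add: N_def)
  have zz: "z \<bullet> z = N\<^sup>2" by (simp add: N_def dot_square_norm)
  have e4: "N powr (\<beta> - 4) * N\<^sup>2 = N powr (\<beta> - 2)"
    using N powr_add[of N "\<beta> - 4" 2] by (simp add: powr_numeral)
  have tr: "(\<Sum>i\<in>UNIV. (k *\<^sub>R phess \<beta> z (axis i 1)) $ i)
      = k * \<beta> * N powr (\<beta> - 2) * (real CARD('n) + (\<beta> - 2))"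
  proof -
    have "(\<Sum>i\<in>UNIV. (k *\<^sub>R phess \<beta> z (axis i 1)) $ i)
      = (\<Sum>i\<in>(UNIV::'n set). k * \<beta> * N powr (\<beta> - 2) + k * \<beta> * (\<beta> - 2) * N powr (\<beta> - 4) * (z $ i * z $ i))"
      by (intro sum.cong refl)
        (simp add: phess_def N_def inner_axis algebra_simps)
    also have "\<dots> = k * \<beta> * N powr (\<beta> - 2) * real CARD('n) + k * \<beta> * (\<beta> - 2) * N powr (\<beta> - 4) * (z \<bullet> z)"
      by (simp add: sum.distrib sum_distrib_left[symmetric] inner_vec_def)
    also have "\<dots> = k * \<beta> * N powr (\<beta> - 2) * real CARD('n) + k * \<beta> * (\<beta> - 2) * (N powr (\<beta> - 4) * N\<^sup>2)"
      by (simp add: zz)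
    also have "\<dots> = k * \<beta> * N powr (\<beta> - 2) * (real CARD('n) + (\<beta> - 2))"
      unfolding e4 by (simp add: algebra_simps)
    finally show ?thesis .
  qed
  define L where "L = k * \<beta> * N powr (\<beta> - 2)"
  have L: "L \<noteq> 0" using N k \<beta> by (simp add: L_def)
  have \<eta>: "k *\<^sub>R pgrad \<beta> z = L *\<^sub>R z" by (simp add: pgrad_def L_def N_def)
  \<comment> \<open>\<open>z\<close> is an eigenvector of the Hessian with eigenvalue
    \<open>L * (\<beta> - 1)\<close>.\<close>
  have Hz: "k *\<^sub>R phess \<beta> z (L *\<^sub>R z) = (L * L * (\<beta> - 1)) *\<^sub>R z"
  proof -
    have "k *\<^sub>R phess \<beta> z (L *\<^sub>R z)
      = (k * \<beta> * N powr (\<beta> - 2) * L + k * \<beta> * (\<beta> - 2) * L * (N powr (\<beta> - 4) * N\<^sup>2)) *\<^sub>R z"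
      by (simp add: phess_def zz N_def[symmetric] algebra_simps)
    also have "\<dots> = (L * L * (\<beta> - 1)) *\<^sub>R z"
      unfolding e4 L_def by (simp add: algebra_simps)
    finally show ?thesis .
  qed
  have quad: "(p - 2) / (norm (L *\<^sub>R z))\<^sup>2 * ((L *\<^sub>R z) \<bullet> (k *\<^sub>R phess \<beta> z (L *\<^sub>R z)))
      = (p - 2) * L * (\<beta> - 1)"
  proof -
    have "(L *\<^sub>R z) \<bullet> (k *\<^sub>R phess \<beta> z (L *\<^sub>R z)) = (norm (L *\<^sub>R z))\<^sup>2 * (L * (\<beta> - 1))"
      unfolding Hz by (simp add: zz N_def[symmetric] power_mult_distrib power2_eq_square)
    moreover have "(norm (L *\<^sub>R z))\<^sup>2 \<noteq> 0" using L z by simp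
    moreover have "(p - 2) / X * Y = (p - 2) * L * (\<beta> - 1)" if "Y = X * (L * (\<beta> - 1))" "X \<noteq> 0" for X Y :: real
      using that by simp
    ultimately show ?thesis by blast
  qed
  have qt: "quasi_trace p (k *\<^sub>R pgrad \<beta> z) (\<lambda>h. k *\<^sub>R phess \<beta> z h)
      = L * (real CARD('n) - 1 + (p - 1) * (\<beta> - 1))"
    unfolding quasi_trace_def tr \<eta> quad by (simp add: L_def algebra_simps)
  have "norm (k *\<^sub>R pgrad \<beta> z) powr (q - 2) = (\<bar>k\<bar> * \<beta> * N powr (\<beta> - 1)) powr (q - 2)"
    using \<beta> by (simp add: norm_pgrad N_def mult.assoc)
  also have "\<dots> = \<bar>k\<bar> powr (q - 2) * \<beta> powr (q - 2) * N powr ((\<beta> - 1) * (q - 2))"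
    using \<beta> by (simp add: powr_mult powr_powr)
  finally have n: "norm (k *\<^sub>R pgrad \<beta> z) powr (q - 2)
      = \<bar>k\<bar> powr (q - 2) * \<beta> powr (q - 2) * N powr ((\<beta> - 1) * (q - 2))" .
  have k1: "\<bar>k\<bar> powr (q - 2) * k = sgn k * \<bar>k\<bar> powr (q - 1)"
    using k powr_add[of "\<bar>k\<bar>" "q - 2" 1] by (simp add: sgn_if)
  have b1: "\<beta> powr (q - 2) * \<beta> = \<beta> powr (q - 1)"
    using \<beta> powr_add[of \<beta> "q - 2" 1] by simp
  have n1: "N powr ((\<beta> - 1) * (q - 2)) * N powr (\<beta> - 2) = N powr ((\<beta> - 1) * (q - 1) - 1)"
    unfolding powr_add[symmetric] by (simp add: algebra_simps)
  have "\<bar>k\<bar> powr (q - 2) * \<beta> powr (q - 2) * N powr ((\<beta> - 1) * (q - 2)) * (L * X)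
     = (\<bar>k\<bar> powr (q - 2) * k) * (\<beta> powr (q - 2) * \<beta>) * X * (N powr ((\<beta> - 1) * (q - 2)) * N powr (\<beta> - 2))" for X
    by (simp add: L_def mult_ac)
  then show ?thesis
    unfolding qt n k1 b1 n1 radial_const_def by (simp add: N_def mult_ac)
qed

text \<open>By \<open>F_pq_radial\<close>, F along the radial function is a constant times |x|^s
  with s = (beta-1)(q-1) - 1, so the hypothesis \<open>s\<close> is exactly what makes it tend to 0;
  \<open>beta > 2\<close> makes the second derivative vanish at 0.\<close>

lemma powr_in_radial_class:
  assumes \<beta>: "\<beta> > 2" and s: "(\<beta> - 1) * (q - 1) > 1" and A: "A > 0"
  shows "(\<lambda>r. A * r powr \<beta>) \<in> radial_class (F_pq p q :: real^'n \<Rightarrow> real^'n^'n \<Rightarrow> real)"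
proof -
  have d1: "((\<lambda>r. A * r powr \<beta>) has_real_derivative A * pgrad \<beta> r) (at r within {0..})"
    if "r \<ge> 0" for r :: real
  proof -
    \<comment> \<open>On the real line \<open>pnorm\<close> is the even extension of r^beta, so
      two-sided derivatives can be restricted to obtain the one-sided ones at 0.\<close>
    have "(pnorm \<beta> has_real_derivative pgrad \<beta> r) (at r)"
      using pnorm_has_derivative[OF \<beta>, of r] by (simp add: has_field_derivative_def mult_commute_abs)
    then have "((\<lambda>r. A * pnorm \<beta> r) has_real_derivative A * pgrad \<beta> r) (at r within {0..})"
      by (rule DERIV_cmult[OF has_field_derivative_at_within])
    then show ?thesis
      by (rule has_field_derivative_transform_within[where d = 1]) (use that in \<open>auto simp: pnorm_def\<close>)
  qed
  have d2: "((\<lambda>r. A * pgrad \<beta> r) has_real_derivative A * phess \<beta> r 1) (at r within {0..})" for r :: real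
  proof -
    have "phess \<beta> r = (*) (phess \<beta> r 1)"
      by (simp add: phess_def fun_eq_iff algebra_simps)
    then have "(pgrad \<beta> has_real_derivative phess \<beta> r 1) (at r)"
      using pgrad_has_derivative[OF \<beta>, of r] by (simp add: has_field_derivative_def)
    then show ?thesis
      by (rule DERIV_cmult[OF has_field_derivative_at_within])
  qed
  have c2: "continuous_on {0..} (\<lambda>r::real. A * phess \<beta> r 1)"
    by (intro continuous_intros continuous_on_subset[OF continuous_on_phess[OF \<beta>]]) auto
  have pos: "A * phess \<beta> r 1 > 0" if "r > 0" for r :: real
    using that \<beta> A by (auto simp: phess_def intro!: mult_pos_pos add_pos_nonneg)
  have F: "F_pq p q (grad (\<lambda>y. A * norm y powr \<beta>) x) (hess (\<lambda>y. A * norm y powr \<beta>) x)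
     = A powr (q - 1) * radial_const p q \<beta> CARD('n) * norm x powr ((\<beta> - 1) * (q - 1) - 1)"
    if "x \<noteq> 0" for x :: "real^'n"
  proof -
    have jet: "has_jet (\<lambda>y. A * norm y powr \<beta>) x (A *\<^sub>R pgrad \<beta> x) (\<lambda>h. A *\<^sub>R phess \<beta> x h)"
      using has_jet_pnorm[OF \<beta>, of 0 A 0 0 0 x] by (simp add: pnorm_def)
    have "hess (\<lambda>y. A * norm y powr \<beta>) x = matrix (\<lambda>h. A *\<^sub>R phess \<beta> x h)"
      by (simp add: hess_def jacobian_def frechet_derivative_at[OF has_jet_grad(2)[OF jet], symmetric])
    then show ?thesis
      using F_pq_radial[OF \<beta> _ that, of A q p] A
      by (simp add: has_jet_grad(1)[OF jet] F_pq_matrix[OF has_jet_linear[OF jet]])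
  qed
  have "((\<lambda>x::real^'n. A powr (q - 1) * radial_const p q \<beta> CARD('n) * norm x powr ((\<beta> - 1) * (q - 1) - 1))
      \<longlongrightarrow> A powr (q - 1) * radial_const p q \<beta> CARD('n) * norm (0::real^'n) powr ((\<beta> - 1) * (q - 1) - 1)) (at 0)"
    using s by (intro tendsto_intros) (auto intro!: tendsto_norm_zero)
  then have "((\<lambda>x::real^'n. A powr (q - 1) * radial_const p q \<beta> CARD('n) * norm x powr ((\<beta> - 1) * (q - 1) - 1))
      \<longlongrightarrow> 0) (at 0)" by simp
  then have "((\<lambda>x::real^'n. F_pq p q (grad (\<lambda>y. A * norm y powr \<beta>) x) (hess (\<lambda>y. A * norm y powr \<beta>) x))
      \<longlongrightarrow> 0) (at 0)"
    by (rule Lim_transform_eventually) (auto simp: eventually_at_filter F)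
  then show ?thesis
    unfolding radial_class_def mem_Collect_eq
    by (intro conjI exI[of _ "\<lambda>r. A * pgrad \<beta> r"] exI[of _ "\<lambda>r. A * phess \<beta> r 1"]
        allI impI d1 d2 c2 pos) simp_all
qed

lemma pnorm_in_Sigma_class:
  assumes "\<beta> > 2"
  shows "pnorm \<beta> \<in> Sigma_class"
proof -
  have d: "(pnorm \<beta> has_real_derivative pgrad \<beta> r) (at r)" for r
    using pnorm_has_derivative[OF assms, of r] by (simp add: has_field_derivative_def mult_commute_abs)
  have "continuous_on UNIV (pgrad \<beta> :: real \<Rightarrow> real)"
    by (intro continuous_at_imp_continuous_on ballI has_derivative_continuous[OF pgrad_has_derivative[OF assms]])
  then have "pnorm \<beta> C1_differentiable_on (UNIV :: real set)"
    unfolding C1_differentiable_on_def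
    using d by (auto simp: has_real_derivative_iff_has_vector_derivative)
  then show ?thesis
    using DERIV_imp_deriv[OF d[of 0]] by (simp add: Sigma_class_def) (simp add: pnorm_def)
qed

section \<open>Space-time barriers and their perturbation to strict test functions\<close>

definition barrier :: "real \<Rightarrow> 'a::real_inner \<Rightarrow> real \<Rightarrow> real \<Rightarrow> real \<Rightarrow> real \<Rightarrow> 'a \<times> real \<Rightarrow> real" where
  "barrier \<beta> x0 t0 c a b = (\<lambda>\<xi>. c + a * pnorm \<beta> (fst \<xi> - x0) + b * (snd \<xi> - t0))"

lemma has_jet_barrier:
  assumes "\<beta> > 2"
  shows "has_jet (\<lambda>y. barrier \<beta> x0 t0 c a b (y, t)) x (a *\<^sub>R pgrad \<beta> (x - x0)) (\<lambda>h. a *\<^sub>R phess \<beta> (x - x0) h)"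
  using has_jet_pnorm[OF assms, of "c + b * (t - t0)" a x0 0 0 x]
  by (simp add: barrier_def algebra_simps)

lemma continuous_on_pnorm: "\<beta> > 2 \<Longrightarrow> continuous_on S (pnorm \<beta>)"
  by (intro continuous_at_imp_continuous_on ballI has_derivative_continuous[OF pnorm_has_derivative])

lemma continuous_on_barrier: "\<beta> > 2 \<Longrightarrow> continuous_on S (barrier \<beta> x0 t0 c a b)"
  unfolding barrier_def
  by (intro continuous_intros continuous_on_compose2[OF continuous_on_pnorm[of \<beta> UNIV]]) auto

text \<open>Because \<open>beta > 2\<close>, the penalties have zero first and second derivatives at
  \<open>\<zeta>\<close>: they make contact strict without changing the gradient, the Hessian or the
  time derivative there. Reusing the exponent \<open>\<beta>\<close> keeps the deviation inside the
  radial and time classes.\<close>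

definition test_fun :: "real \<Rightarrow> 'a::real_inner \<Rightarrow> real \<Rightarrow> real \<Rightarrow> real \<Rightarrow> real \<Rightarrow> 'a \<times> real \<Rightarrow> 'a \<times> real \<Rightarrow> real" where
  "test_fun \<beta> x0 t0 c a b \<zeta> = (\<lambda>\<xi>. barrier \<beta> x0 t0 c a b \<xi>
     - pnorm \<beta> (fst \<xi> - fst \<zeta>) - pnorm \<beta> (snd \<xi> - snd \<zeta>))"

lemma C2_on_test_fun:
  fixes x0 :: "'a::euclidean_space"
  assumes "\<beta> > 2"
  shows "C2_on S (test_fun \<beta> x0 t0 c a b \<zeta>)"
proof (rule C2_onI_gderiv)
  fix \<xi> :: "'a \<times> real"
  define G where "G = (\<lambda>\<xi>::'a \<times> real. (a *\<^sub>R pgrad \<beta> (fst \<xi> - x0) - pgrad \<beta> (fst \<xi> - fst \<zeta>), b - pgrad \<beta> (snd \<xi> - snd \<zeta>)))"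
  define G' where "G' = (\<lambda>\<xi> h::'a \<times> real. (a *\<^sub>R phess \<beta> (fst \<xi> - x0) (fst h) - phess \<beta> (fst \<xi> - fst \<zeta>) (fst h),
      - phess \<beta> (snd \<xi> - snd \<zeta>) (snd h)))"
  show "GDERIV (test_fun \<beta> x0 t0 c a b \<zeta>) \<xi> :> G \<xi>"
    unfolding gderiv_def test_fun_def barrier_def
    by (auto intro!: derivative_eq_intros has_derivative_comp_diff pnorm_has_derivative assms
        simp: G_def inner_prod_def inner_diff_right fun_eq_iff algebra_simps)
  show "(G has_derivative G' \<xi>) (at \<xi>)"
  proof -
    have "((\<lambda>\<xi>. b - pgrad \<beta> (snd \<xi> - snd \<zeta>)) has_derivative (\<lambda>h. 0 - phess \<beta> (snd \<xi> - snd \<zeta>) (snd h))) (at \<xi>)"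
      by (rule has_derivative_diff[OF has_derivative_const
            has_derivative_comp_diff[OF pgrad_has_derivative[OF assms] has_derivative_snd[OF has_derivative_ident]]])
    moreover have "((\<lambda>\<xi>. a *\<^sub>R pgrad \<beta> (fst \<xi> - x0) - pgrad \<beta> (fst \<xi> - fst \<zeta>)) has_derivative
      (\<lambda>h. a *\<^sub>R phess \<beta> (fst \<xi> - x0) (fst h) - phess \<beta> (fst \<xi> - fst \<zeta>) (fst h))) (at \<xi>)"
    proof -
      have *: "((\<lambda>\<xi>. pgrad \<beta> (fst \<xi> - z)) has_derivative (\<lambda>h. phess \<beta> (fst \<xi> - z) (fst h))) (at \<xi>)" for z
        by (rule has_derivative_comp_diff[OF pgrad_has_derivative[OF assms] has_derivative_fst[OF has_derivative_ident]])
      show ?thesis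
        by (rule has_derivative_diff[OF has_derivative_scaleR_right[OF *] *])
    qed
    ultimately show ?thesis
      unfolding G_def G'_def by (auto intro: has_derivative_Pair)
  qed
  show "continuous_on S (\<lambda>\<xi>. G' \<xi> h)" for h
    unfolding G'_def
    by (intro continuous_intros continuous_on_compose2[OF continuous_on_phess[OF assms]]) auto
qed

lemma test_fun_deriv_t:
  assumes "\<beta> > 2"
  shows "deriv_t (test_fun \<beta> x0 t0 c a b \<zeta>) \<zeta> = b"
proof -
  have "(pnorm \<beta> has_real_derivative 0) (at (0::real))"
    using pnorm_has_derivative[OF assms, of "0::real"]
    by (simp add: has_field_derivative_def lambda_zero[symmetric])
  then have "((\<lambda>s. pnorm \<beta> (s - snd \<zeta>)) has_real_derivative 0) (at (snd \<zeta>))"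
    using DERIV_shift[of "pnorm \<beta>" 0 "snd \<zeta>" "- snd \<zeta>"] by simp
  then have "((\<lambda>s. test_fun \<beta> x0 t0 c a b \<zeta> (fst \<zeta>, s)) has_real_derivative b) (at (snd \<zeta>))"
    unfolding test_fun_def barrier_def by (auto intro!: derivative_eq_intros)
  then show ?thesis unfolding deriv_t_def by (rule DERIV_imp_deriv)
qed

lemma has_jet_test_fun:
  assumes "\<beta> > 2"
  shows "has_jet (\<lambda>y. test_fun \<beta> x0 t0 c a b \<zeta> (y, snd \<zeta>)) (fst \<zeta>)
     (a *\<^sub>R pgrad \<beta> (fst \<zeta> - x0)) (\<lambda>h. a *\<^sub>R phess \<beta> (fst \<zeta> - x0) h)"
  using has_jet_pnorm[OF assms, of "c + b * (snd \<zeta> - t0)" a x0 "-1" "fst \<zeta>" "fst \<zeta>"]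
  by (simp add: test_fun_def barrier_def algebra_simps)

text \<open>The gradient at \<open>\<zeta>\<close> vanishes only if \<open>a = 0\<close> or
  \<open>\<zeta>\<close> lies on the axis over \<open>x0\<close>. In either case all spatial powers
  that remain are centred at \<open>fst \<zeta>\<close>, so a single radial function with
  coefficient |a| + 1 bounds the deviation.\<close>

lemma test_fun_admissible:
  fixes x0 :: "real^'n"
  assumes \<beta>: "\<beta> > 2" and s: "(\<beta> - 1) * (q - 1) > 1" and "open \<Theta>" and "\<zeta> \<in> \<Theta>"
  shows "admissible_at p q \<Theta> (test_fun \<beta> x0 t0 c a b \<zeta>) \<zeta>"
proof (cases "a = 0 \<or> fst \<zeta> = x0")
  case False
  then have "grad_x (test_fun \<beta> x0 t0 c a b \<zeta>) \<zeta> \<noteq> 0"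
    using has_jet_grad(1)[OF has_jet_test_fun[OF \<beta>, of x0 t0 c a b \<zeta>]] \<beta>
    by (simp add: grad_x_def pgrad_eq_0_iff)
  then show ?thesis by (simp add: admissible_at_def)
next
  case True
  obtain A B where AB: "open A" "open B" "\<zeta> \<in> A \<times> B" "A \<times> B \<subseteq> \<Theta>"
    using assms(3,4) by (rule open_prod_elim)
  obtain d where d: "d > 0" "ball (fst \<zeta>) d \<subseteq> A"
    using AB openE[of A "fst \<zeta>"] by (auto simp: mem_Times_iff)
  obtain e where e: "e > 0" "ball (snd \<zeta>) e \<subseteq> B"
    using AB openE[of B "snd \<zeta>"] by (auto simp: mem_Times_iff)
  define \<delta> where "\<delta> = min d e"
  have "ball (fst \<zeta>) \<delta> \<times> {snd \<zeta> - \<delta> <..< snd \<zeta> + \<delta>} \<subseteq> A \<times> B"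
    using d(2) e(2) by (fastforce simp: \<delta>_def dist_real_def)
  then have sub: "ball (fst \<zeta>) \<delta> \<times> {snd \<zeta> - \<delta> <..< snd \<zeta> + \<delta>} \<subseteq> \<Theta>"
    using AB(4) by blast
  have bd: "\<bar>test_fun \<beta> x0 t0 c a b \<zeta> (x, t) - test_fun \<beta> x0 t0 c a b \<zeta> \<zeta> - b * (t - snd \<zeta>)\<bar>
     \<le> (\<bar>a\<bar> + 1) * norm (x - fst \<zeta>) powr \<beta> + pnorm \<beta> (t - snd \<zeta>)" for x t
  proof -
    have "test_fun \<beta> x0 t0 c a b \<zeta> (x, t) - test_fun \<beta> x0 t0 c a b \<zeta> \<zeta> - b * (t - snd \<zeta>)
      = a * pnorm \<beta> (x - fst \<zeta>) - pnorm \<beta> (x - fst \<zeta>) - pnorm \<beta> (t - snd \<zeta>)"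
      using True by (auto simp: test_fun_def barrier_def algebra_simps)
    also have "\<bar>\<dots>\<bar> \<le> \<bar>a * pnorm \<beta> (x - fst \<zeta>)\<bar> + pnorm \<beta> (x - fst \<zeta>) + pnorm \<beta> (t - snd \<zeta>)"
      using pnorm_nonneg[of \<beta> "x - fst \<zeta>"] pnorm_nonneg[of \<beta> "t - snd \<zeta>"] by linarith
    also have "\<dots> = (\<bar>a\<bar> + 1) * norm (x - fst \<zeta>) powr \<beta> + pnorm \<beta> (t - snd \<zeta>)"
      by (simp add: abs_mult pnorm_def[of \<beta> "x - fst \<zeta>"] algebra_simps)
    finally show ?thesis .
  qed
  have "\<bar>a\<bar> + 1 > 0" by simp
  then have rc: "(\<lambda>r. (\<bar>a\<bar> + 1) * r powr \<beta>) \<in> radial_class (F_pq p q :: real^'n \<Rightarrow> real^'n^'n \<Rightarrow> real)"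
    by (rule powr_in_radial_class[OF \<beta> s])
  have "\<delta> > 0" using d(1) e(1) by (simp add: \<delta>_def)
  then show ?thesis
    unfolding admissible_at_def test_fun_deriv_t[OF \<beta>]
    by (intro disjI2 exI[of _ \<delta>] conjI bexI[OF _ rc] bexI[OF _ pnorm_in_Sigma_class[OF \<beta>]] sub ballI bd)
qed

section \<open>Comparison with barriers\<close>

text \<open>If the infimum of u minus the barrier were negative, the boundary condition would keep
  minimizing sequences away from the frontier of \<open>D\<close>, lower semicontinuity would give
  an interior minimum, and testing there contradicts \<open>strict\<close>. The bound
  \<open>m\<close> only keeps that infimum finite, so it may depend on \<open>u\<close>.
  \<open>D\<close> is separate from Theta because \<open>strict\<close> may hold only in a
  cylinder.\<close>

lemma supersol_ge_barrier:
  fixes \<Theta> D :: "((real^'n) \<times> real) set"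
  assumes p: "p > 1" and \<beta>: "\<beta> > 2" and s: "(\<beta> - 1) * (q - 1) > 1"
    and \<Theta>: "open \<Theta>" and u: "viscosity_supersol p q \<Theta> u"
    and D: "open D" "D \<subseteq> \<Theta>" "bounded D"
    and m: "\<And>\<xi>. \<xi> \<in> D \<Longrightarrow> ereal m \<le> u \<xi>"
    and a: "a \<ge> 0"
    and strict: "\<And>\<xi>. \<xi> \<in> D \<Longrightarrow> a powr (q - 1) * radial_const p q \<beta> CARD('n)
      * norm (fst \<xi> - x0) powr ((\<beta> - 1) * (q - 1) - 1) < b"
    and bd: "\<And>\<xi>. \<xi> \<in> frontier D \<Longrightarrow>
      ereal (barrier \<beta> x0 t0 c (- a) (- b) \<xi>) \<le> Liminf (at \<xi> within D) u"
    and \<xi>: "\<xi> \<in> D"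
  shows "ereal (barrier \<beta> x0 t0 c (- a) (- b) \<xi>) \<le> u \<xi>"
proof (rule ccontr)
  assume contra: "\<not> ?thesis"
  define v where "v = barrier \<beta> x0 t0 c (- a) (- b)"
  have vc: "continuous_on A v" for A
    unfolding v_def by (rule continuous_on_barrier[OF \<beta>])
  define \<Phi> where "\<Phi> = (\<lambda>\<xi>. u \<xi> - ereal (v \<xi>))"
  have u_\<Phi>: "u \<zeta> = \<Phi> \<zeta> + ereal (v \<zeta>)" for \<zeta>
    unfolding \<Phi>_def by (cases "u \<zeta>") auto
  have cpt: "compact (closure D)" using D(3) by simp
  then have "bounded (v ` closure D)"
    by (intro compact_imp_bounded compact_continuous_image vc)
  then obtain V where V: "\<And>\<zeta>. \<zeta> \<in> closure D \<Longrightarrow> \<bar>v \<zeta>\<bar> \<le> V"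
    by (auto simp: bounded_iff)
  define I where "I = (INF \<zeta>\<in>D. \<Phi> \<zeta>)"
  have "ereal (m - V) \<le> I"
    unfolding I_def
  proof (rule INF_greatest)
    fix \<zeta> assume "\<zeta> \<in> D"
    then have "ereal m \<le> u \<zeta>" "\<bar>v \<zeta>\<bar> \<le> V" using m V closure_subset by blast+
    then show "ereal (m - V) \<le> \<Phi> \<zeta>"
      unfolding \<Phi>_def by (cases "u \<zeta>") auto
  qed
  moreover have I_le: "I \<le> \<Phi> \<zeta>" if "\<zeta> \<in> D" for \<zeta>
    unfolding I_def using that by (rule INF_lower)
  moreover have "\<Phi> \<xi> < 0"
    using contra unfolding \<Phi>_def v_def[symmetric] by (cases "u \<xi>") auto
  ultimately have "I \<noteq> - \<infinity>" "I < 0"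
    using le_less_trans[OF I_le[OF \<xi>]] by auto
  then obtain \<mu> where \<mu>: "I = ereal \<mu>" "\<mu> < 0" by (cases I) auto
  obtain w where w: "\<And>n. w n \<in> \<Phi> ` D" "w \<longlonglongrightarrow> I"
    using Inf_as_limit[of "\<Phi> ` D"] \<xi> unfolding I_def by blast
  then have "\<forall>n. \<exists>\<zeta>. \<zeta> \<in> D \<and> w n = \<Phi> \<zeta>" by blast
  then obtain X where X: "\<And>n. X n \<in> D" "\<And>n. w n = \<Phi> (X n)" by metis
  obtain \<zeta> r where \<zeta>: "\<zeta> \<in> closure D" "strict_mono r" "(X \<circ> r) \<longlonglongrightarrow> \<zeta>"
    using cpt X(1) closure_subset unfolding compact_def by (metis subsetD)
  have Xr: "filterlim (\<lambda>n. X (r n)) (nhds \<zeta>) sequentially"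
    using \<zeta>(3) by (simp add: o_def)
  have lim: "(\<lambda>n. u (X (r n))) \<longlonglongrightarrow> ereal (\<mu> + v \<zeta>)"
  proof -
    have "(\<lambda>n. \<Phi> (X (r n))) \<longlonglongrightarrow> ereal \<mu>"
      using LIMSEQ_subseq_LIMSEQ[OF w(2) \<zeta>(2)] by (simp add: X(2) \<mu> o_def)
    moreover have "(\<lambda>n. v (X (r n))) \<longlonglongrightarrow> v \<zeta>"
      by (rule continuous_on_tendsto_compose[OF vc[of UNIV] Xr]) auto
    ultimately have "(\<lambda>n. \<Phi> (X (r n)) + ereal (v (X (r n)))) \<longlonglongrightarrow> ereal \<mu> + ereal (v \<zeta>)"
      by (intro tendsto_add_ereal) (auto intro: tendsto_intros)
    then show ?thesis by (simp add: u_\<Phi>[symmetric])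
  qed
  \<comment> \<open>Serves the frontier and the interior alike. The filter is \<open>nhds\<close>
    restricted to \<open>D\<close>, not the punctured one, because the minimizing sequence may hit
    \<open>\<zeta>\<close> itself.\<close>
  have key: "L \<le> ereal (\<mu> + v \<zeta>)" if "\<And>y. y < L \<Longrightarrow> \<forall>\<^sub>F \<eta> in nhds \<zeta>. \<eta> \<in> D \<longrightarrow> y < u \<eta>" for L
  proof (rule dense_le)
    fix y assume "y < L"
    have "\<forall>\<^sub>F n in sequentially. y \<le> u (X (r n))"
      using eventually_compose_filterlim[OF that[OF \<open>y < L\<close>] Xr] X(1) by (auto elim: eventually_mono)
    then show "y \<le> ereal (\<mu> + v \<zeta>)"
      by (rule tendsto_lowerbound[OF lim]) simp
  qed
  have \<zeta>D: "\<zeta> \<in> D"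
  proof (rule ccontr)
    assume n: "\<zeta> \<notin> D"
    then have "\<zeta> \<in> frontier D" using \<zeta>(1) D(1) by (simp add: frontier_def interior_open)
    then have L: "ereal (v \<zeta>) \<le> Liminf (at \<zeta> within D) u" unfolding v_def by (rule bd)
    have "ereal (v \<zeta>) \<le> ereal (\<mu> + v \<zeta>)"
    proof (rule key)
      fix y assume "y < ereal (v \<zeta>)"
      with L have "\<forall>\<^sub>F \<eta> in at \<zeta> within D. y < u \<eta>" by (simp add: le_Liminf_iff)
      then show "\<forall>\<^sub>F \<eta> in nhds \<zeta>. \<eta> \<in> D \<longrightarrow> y < u \<eta>"
        unfolding eventually_at_filter by (rule eventually_mono) (use n in auto)
    qed
    then show False using \<mu>(2) by simp
  qed
  have \<zeta>\<Theta>: "\<zeta> \<in> \<Theta>" using \<zeta>D D(2) by blast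
  have "u \<zeta> \<le> ereal (\<mu> + v \<zeta>)"
  proof (rule key)
    fix y assume y: "y < u \<zeta>"
    have "u \<zeta> \<le> Liminf (at \<zeta> within \<Theta>) u"
      using u \<zeta>\<Theta> by (simp add: viscosity_supersol_def lsc_on_def)
    with y have "\<forall>\<^sub>F \<eta> in at \<zeta> within \<Theta>. y < u \<eta>" by (simp add: le_Liminf_iff)
    then show "\<forall>\<^sub>F \<eta> in nhds \<zeta>. \<eta> \<in> D \<longrightarrow> y < u \<eta>"
      unfolding eventually_at_filter by (rule eventually_mono) (use y D(2) in auto)
  qed
  moreover have ge: "ereal (\<mu> + v \<eta>) \<le> u \<eta>" if "\<eta> \<in> D" for \<eta>
    using I_le[OF that] unfolding \<mu> \<Phi>_def by (cases "u \<eta>") auto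
  ultimately have u\<zeta>: "u \<zeta> = ereal (\<mu> + v \<zeta>)" using \<zeta>D by (simp add: order_antisym)
  \<comment> \<open>Shifting by the minimum value \<open>\<mu>\<close> moves the barrier into
    contact with \<open>u\<close> at \<open>\<zeta>\<close>.\<close>
  define \<phi> where "\<phi> = test_fun \<beta> x0 t0 (c + \<mu>) (- a) (- b) \<zeta>"
  have \<phi>_eq: "\<phi> \<eta> = \<mu> + v \<eta> - pnorm \<beta> (fst \<eta> - fst \<zeta>) - pnorm \<beta> (snd \<eta> - snd \<zeta>)" for \<eta>
    by (simp add: \<phi>_def test_fun_def v_def barrier_def)
  have touch: "touches_below \<Theta> \<phi> u \<zeta>"
    unfolding touches_below_def
  proof
    show "ereal (\<phi> \<zeta>) = u \<zeta>" by (simp add: \<phi>_eq u\<zeta>)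
    have "\<forall>\<^sub>F \<eta> in at \<zeta> within \<Theta>. \<eta> \<in> D"
      using D(1) \<zeta>D by (intro eventually_at_in_open'[THEN filter_leD[OF at_le[of _ UNIV], rotated]]) auto
    moreover have "\<forall>\<^sub>F \<eta> in at \<zeta> within \<Theta>. \<eta> \<noteq> \<zeta>"
      by (simp add: eventually_at_filter)
    ultimately show "\<forall>\<^sub>F \<eta> in at \<zeta> within \<Theta>. ereal (\<phi> \<eta>) < u \<eta>"
    proof eventually_elim
      case (elim \<eta>)
      then have "pnorm \<beta> (fst \<eta> - fst \<zeta>) > 0 \<or> pnorm \<beta> (snd \<eta> - snd \<zeta>) > 0"
        by (auto simp: pnorm_def prod_eq_iff)
      then have "\<phi> \<eta> < \<mu> + v \<eta>"
        unfolding \<phi>_eq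
        using pnorm_nonneg[of \<beta> "fst \<eta> - fst \<zeta>"] pnorm_nonneg[of \<beta> "snd \<eta> - snd \<zeta>"] by linarith
      then have "ereal (\<phi> \<eta>) < ereal (\<mu> + v \<eta>)" by simp
      also have "\<dots> \<le> u \<eta>" using elim(1) by (rule ge)
      finally show ?case .
    qed
  qed
  have "C2_on \<Theta> \<phi>" unfolding \<phi>_def by (rule C2_on_test_fun[OF \<beta>])
  moreover have "admissible_at p q \<Theta> \<phi> \<zeta>"
    unfolding \<phi>_def by (rule test_fun_admissible[OF \<beta> s \<Theta> \<zeta>\<Theta>])
  ultimately have sup: "(grad_x \<phi> \<zeta> \<noteq> 0 \<longrightarrow> deriv_t \<phi> \<zeta> - Delta_pq_x p q \<phi> \<zeta> \<ge> 0) \<and>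
        (grad_x \<phi> \<zeta> = 0 \<longrightarrow> deriv_t \<phi> \<zeta> \<ge> 0)"
    using u \<zeta>\<Theta> touch unfolding viscosity_supersol_def by blast
  have jet: "has_jet (\<lambda>y. \<phi> (y, snd \<zeta>)) (fst \<zeta>) (- a *\<^sub>R pgrad \<beta> (fst \<zeta> - x0))
      (\<lambda>h. - a *\<^sub>R phess \<beta> (fst \<zeta> - x0) h)"
    unfolding \<phi>_def by (rule has_jet_test_fun[OF \<beta>])
  have gr: "grad_x \<phi> \<zeta> = - a *\<^sub>R pgrad \<beta> (fst \<zeta> - x0)"
    unfolding grad_x_def by (rule has_jet_grad(1)[OF jet])
  have dt: "deriv_t \<phi> \<zeta> = - b" unfolding \<phi>_def by (rule test_fun_deriv_t[OF \<beta>])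
  have C: "radial_const p q \<beta> CARD('n) > 0" by (rule radial_const_pos[OF p \<beta>]) simp
  show False
  \<comment> \<open>With zero gradient the viscosity inequality reads \<open>- b \<ge> 0\<close>,
    while \<open>strict\<close> forces \<open>b > 0\<close>. With nonzero gradient it says that
    \<open>b\<close> is at most the left side of \<open>strict\<close> at
    \<open>\<zeta>\<close>.\<close>
  proof (cases "grad_x \<phi> \<zeta> = 0")
    case True
    have "0 \<le> a powr (q - 1) * radial_const p q \<beta> CARD('n)
      * norm (fst \<zeta> - x0) powr ((\<beta> - 1) * (q - 1) - 1)" using C by simp
    then have "b > 0" using strict[OF \<zeta>D] by linarith
    then show False using sup True dt by simp
  next
    case False
    then have nz: "- a \<noteq> 0" "fst \<zeta> - x0 \<noteq> 0" using gr by auto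
    have "Delta_pq_x p q \<phi> \<zeta> = - (a powr (q - 1) * radial_const p q \<beta> CARD('n)
      * norm (fst \<zeta> - x0) powr ((\<beta> - 1) * (q - 1) - 1))"
      unfolding Delta_pq_x_def
      using Delta_pq_jet[OF jet False[unfolded gr], of p q] F_pq_radial[OF \<beta> nz, of q p] a nz
      by (simp add: sgn_if)
    then show False using sup False dt strict[OF \<zeta>D] by simp
  qed
qed

text \<open>At contact the time derivatives agree, and the spatial operators compare by ellipticity.
  Where the gradient vanishes, only \<open>b \<ge> 0\<close> is required. Contact may be non-strict
  and \<open>a = b = 0\<close> is allowed, so constants are covered too.\<close>

lemma test_at_barrier:
  fixes \<Theta> :: "((real^'n) \<times> real) set"
  assumes p: "p > 1" and \<beta>: "\<beta> > 2" and \<Theta>: "open \<Theta>" "\<xi> \<in> \<Theta>" and \<phi>: "C2_on \<Theta> \<phi>"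
    and a: "a \<ge> 0"
    and b: "a powr (q - 1) * radial_const p q \<beta> CARD('n)
      * norm (fst \<xi> - x0) powr ((\<beta> - 1) * (q - 1) - 1) \<le> b"
    and le: "\<forall>\<^sub>F \<eta> in nhds \<xi>. \<phi> \<eta> \<le> barrier \<beta> x0 t0 c a b \<eta>"
    and eq: "\<phi> \<xi> = barrier \<beta> x0 t0 c a b \<xi>"
  shows "(grad_x \<phi> \<xi> \<noteq> 0 \<longrightarrow> deriv_t \<phi> \<xi> - Delta_pq_x p q \<phi> \<xi> \<ge> 0) \<and>
        (grad_x \<phi> \<xi> = 0 \<longrightarrow> deriv_t \<phi> \<xi> \<ge> 0)"
proof -
  define x t where "x = fst \<xi>" and "t = snd \<xi>"
  have \<xi>: "\<xi> = (x, t)" by (simp add: x_def t_def)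
  define W where "W = barrier \<beta> x0 t0 c a b"
  note sl = C2_on_slice[OF \<phi> \<Theta>[unfolded \<xi>]]
  obtain \<eta> H where jet: "has_jet (\<lambda>y. \<phi> (y, t)) x \<eta> H" using sl(1) by blast
  have jetW: "has_jet (\<lambda>y. W (y, t)) x (a *\<^sub>R pgrad \<beta> (x - x0)) (\<lambda>h. a *\<^sub>R phess \<beta> (x - x0) h)"
    unfolding W_def by (rule has_jet_barrier[OF \<beta>])
  have "filterlim (\<lambda>y. (y, t)) (nhds (x, t)) (nhds x)" by (intro tendsto_intros filterlim_ident)
  then have le_x: "\<forall>\<^sub>F y in nhds x. \<phi> (y, t) \<le> W (y, t)"
    using eventually_compose_filterlim[OF le[unfolded \<xi>]] by (simp add: W_def)
  have "filterlim (\<lambda>s. (x, s)) (nhds (x, t)) (nhds t)" by (intro tendsto_intros filterlim_ident)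
  then have le_t: "\<forall>\<^sub>F s in nhds t. \<phi> (x, s) \<le> W (x, s)"
    using eventually_compose_filterlim[OF le[unfolded \<xi>]] by (simp add: W_def)
  have eqW: "\<phi> (x, t) = W (x, t)" using eq by (simp add: \<xi> W_def)
  have dt: "deriv_t \<phi> \<xi> = b"
  proof -
    obtain d where d: "((\<lambda>s. \<phi> (x, s)) has_real_derivative d) (at t)"
      using sl(2) by (auto simp: real_differentiable_def)
    have "((\<lambda>s. W (x, s)) has_real_derivative b) (at t)"
      unfolding W_def barrier_def by (auto intro!: derivative_eq_intros)
    then have D: "((\<lambda>s. W (x, s) - \<phi> (x, s)) has_real_derivative b - d) (at t)"
      using d by (rule DERIV_diff)
    have "(*) (b - d) = (\<lambda>h. 0)"
      by (rule has_derivative_local_min[OF D[unfolded has_field_derivative_def]])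
        (use le_t eqW in \<open>auto simp: eventually_at_filter elim: eventually_mono\<close>)
    then have "(b - d) * 1 = 0" by (rule fun_cong)
    then show ?thesis using DERIV_imp_deriv[OF d] by (simp add: deriv_t_def \<xi>)
  qed
  have gr: "grad_x \<phi> \<xi> = \<eta>" using has_jet_grad(1)[OF jet] by (simp add: grad_x_def \<xi>)
  have C: "radial_const p q \<beta> CARD('n) > 0" by (rule radial_const_pos[OF p \<beta>]) simp
  then have "0 \<le> a powr (q - 1) * radial_const p q \<beta> CARD('n)
      * norm (fst \<xi> - x0) powr ((\<beta> - 1) * (q - 1) - 1)" by simp
  then have b0: "b \<ge> 0" using b by linarith
  note mono = Delta_pq_mono[OF p jet jetW le_x eqW]
  have "deriv_t \<phi> \<xi> - Delta_pq_x p q \<phi> \<xi> \<ge> 0" if nz: "\<eta> \<noteq> 0"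
  proof -
    have nz': "a \<noteq> 0" "x - x0 \<noteq> 0" "a *\<^sub>R pgrad \<beta> (x - x0) \<noteq> 0" using nz mono(1) by auto
    have "Delta_pq p q (\<lambda>y. W (y, t)) x = a powr (q - 1) * radial_const p q \<beta> CARD('n)
      * norm (x - x0) powr ((\<beta> - 1) * (q - 1) - 1)"
      using Delta_pq_jet[OF jetW nz'(3), of p q] F_pq_radial[OF \<beta> nz'(1,2), of q p] a nz'
      by (simp add: sgn_if)
    then show ?thesis
      using mono(2)[OF nz, of q] b by (simp add: Delta_pq_x_def dt) (simp add: \<xi>)
  qed
  then show ?thesis using gr dt b0 by simp
qed

lemma le_Liminf_continuous:
  fixes g :: "'a::metric_space \<Rightarrow> real"
  assumes "continuous_on (closure S) g" and "\<xi> \<in> closure S" and "y \<le> g \<xi>"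
  shows "ereal y \<le> Liminf (at \<xi> within S) (\<lambda>\<eta>. ereal (g \<eta>))"
  unfolding le_Liminf_iff
proof (intro allI impI)
  fix z assume "z < ereal y"
  then have z: "z < ereal (g \<xi>)" using assms(3) by (meson ereal_less_eq(3) less_le_trans)
  have "(g \<longlongrightarrow> g \<xi>) (at \<xi> within S)"
    using assms(1,2) closure_subset[of S]
    by (auto simp: continuous_on_def intro: tendsto_within_subset)
  then have "((\<lambda>\<eta>. ereal (g \<eta>)) \<longlongrightarrow> ereal (g \<xi>)) (at \<xi> within S)" by (intro tendsto_intros)
  then show "\<forall>\<^sub>F \<eta> in at \<xi> within S. z < ereal (g \<eta>)" using z by (rule order_tendstoD)
qed

text \<open>The barrier is a supersolution only inside the cylinder. Replacing it by the constant
  outside is continuous as soon as the barrier is at least \<open>K\<close> on the lateral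
  surface.\<close>

definition capped_barrier ::
  "real \<Rightarrow> 'a::real_inner \<Rightarrow> real \<Rightarrow> real \<Rightarrow> real \<Rightarrow> real \<Rightarrow> real \<Rightarrow> real \<Rightarrow> 'a \<times> real \<Rightarrow> real" where
  "capped_barrier \<beta> x0 t0 c a b \<rho> K = (\<lambda>\<xi>. if norm (fst \<xi> - x0) \<le> \<rho>
     then min K (barrier \<beta> x0 t0 c a b \<xi>) else K)"

lemma continuous_on_capped_barrier:
  assumes "\<beta> > 2" and "\<And>\<xi>. \<xi> \<in> S \<Longrightarrow> norm (fst \<xi> - x0) = \<rho> \<Longrightarrow> K \<le> barrier \<beta> x0 t0 c a b \<xi>"
  shows "continuous_on S (capped_barrier \<beta> x0 t0 c a b \<rho> K)"
  unfolding capped_barrier_def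
  by (rule continuous_on_cases_le) (use assms in \<open>auto intro!: continuous_intros continuous_on_barrier\<close>)

text \<open>A function touching a minimum of two supersolutions from below touches whichever is
  active: the constant where the value is \<open>K\<close>, the barrier otherwise.\<close>

lemma capped_barrier_supersol:
  fixes \<Theta> :: "((real^'n) \<times> real) set"
  assumes p: "p > 1" and \<beta>: "\<beta> > 2" and \<Theta>: "open \<Theta>" and a: "a \<ge> 0"
    and b: "\<And>x. norm (x - x0) \<le> \<rho> \<Longrightarrow> a powr (q - 1) * radial_const p q \<beta> CARD('n)
      * norm (x - x0) powr ((\<beta> - 1) * (q - 1) - 1) \<le> b"
    and K: "\<And>\<xi>. \<xi> \<in> closure \<Theta> \<Longrightarrow> norm (fst \<xi> - x0) = \<rho> \<Longrightarrow> K \<le> barrier \<beta> x0 t0 c a b \<xi>"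
  shows "viscosity_supersol p q \<Theta> (\<lambda>\<xi>. ereal (capped_barrier \<beta> x0 t0 c a b \<rho> K \<xi>))"
proof -
  define W where "W = barrier \<beta> x0 t0 c a b"
  define U where "U = capped_barrier \<beta> x0 t0 c a b \<rho> K"
  have U_le: "U \<eta> \<le> K" for \<eta> by (simp add: U_def capped_barrier_def)
  have cont: "continuous_on (closure \<Theta>) U"
    unfolding U_def by (rule continuous_on_capped_barrier[OF \<beta> K])
  have test: "(grad_x \<phi> \<xi> \<noteq> 0 \<longrightarrow> deriv_t \<phi> \<xi> - Delta_pq_x p q \<phi> \<xi> \<ge> 0) \<and>
        (grad_x \<phi> \<xi> = 0 \<longrightarrow> deriv_t \<phi> \<xi> \<ge> 0)"
    if \<xi>: "\<xi> \<in> \<Theta>" and \<phi>: "C2_on \<Theta> \<phi>" and t: "touches_below \<Theta> \<phi> (\<lambda>\<xi>. ereal (U \<xi>)) \<xi>" for \<phi> \<xi>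
  proof -
    have eq: "\<phi> \<xi> = U \<xi>" and ev: "\<forall>\<^sub>F \<eta> in at \<xi> within \<Theta>. \<phi> \<eta> < U \<eta>"
      using t by (auto simp: touches_below_def)
    have "\<forall>\<^sub>F \<eta> in nhds \<xi>. \<eta> \<in> \<Theta>" using \<Theta> \<xi> by (rule eventually_nhds_in_open)
    with ev[unfolded eventually_at_filter] have le: "\<forall>\<^sub>F \<eta> in nhds \<xi>. \<phi> \<eta> \<le> U \<eta>"
      by eventually_elim (use eq in \<open>metis less_imp_le order_refl\<close>)
    show ?thesis
    proof (cases "U \<xi> = K")
      case True
      \<comment> \<open>The constant \<open>K\<close> is the barrier with zero coefficients.\<close>
      have k: "barrier \<beta> x0 t0 K 0 0 \<eta> = K" for \<eta> by (simp add: barrier_def)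
      have "\<forall>\<^sub>F \<eta> in nhds \<xi>. \<phi> \<eta> \<le> barrier \<beta> x0 t0 K 0 0 \<eta>"
        using le unfolding k by (rule eventually_mono) (use U_le order_trans in blast)
      then show ?thesis
        by (rule test_at_barrier[OF p \<beta> \<Theta> \<xi> \<phi>, rotated 2]) (use eq True k in auto)
    next
      case False
      have r: "norm (fst \<xi> - x0) \<le> \<rho>" and UW: "U \<xi> = W \<xi>" and "W \<xi> < K"
        using False by (auto simp: U_def W_def capped_barrier_def min_def split: if_splits)
      \<comment> \<open>On the lateral surface the barrier is at least \<open>K\<close>, so a value
        below \<open>K\<close> places the point strictly inside, where the barrier bounds the capped
        function on a full neighbourhood.\<close>
      then have "norm (fst \<xi> - x0) < \<rho>"
        using K[of \<xi>] \<xi> closure_subset[of \<Theta>] unfolding W_def by fastforce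
      moreover have "open {\<eta>. norm (fst \<eta> - x0) < \<rho>}"
        by (intro open_Collect_less continuous_intros)
      ultimately have "\<forall>\<^sub>F \<eta> in nhds \<xi>. norm (fst \<eta> - x0) < \<rho>"
        using eventually_nhds_in_open[of "{\<eta>. norm (fst \<eta> - x0) < \<rho>}" \<xi>] by simp
      with le have "\<forall>\<^sub>F \<eta> in nhds \<xi>. \<phi> \<eta> \<le> barrier \<beta> x0 t0 c a b \<eta>"
        by eventually_elim (auto simp: U_def capped_barrier_def)
      then show ?thesis
        by (rule test_at_barrier[OF p \<beta> \<Theta> \<xi> \<phi> a b[OF r]]) (use eq UW W_def in simp)
    qed
  qed
  have "lsc_on \<Theta> (\<lambda>\<xi>. ereal (U \<xi>))"
    unfolding lsc_on_def using le_Liminf_continuous[OF cont] closure_subset by blast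
  moreover have "\<Theta> \<subseteq> closure {\<xi>\<in>\<Theta>. \<bar>ereal (U \<xi>)\<bar> \<noteq> \<infinity>}"
    using closure_subset by simp
  ultimately show ?thesis
    unfolding viscosity_supersol_def U_def[symmetric] using test by simp
qed

section \<open>Choice of the parameters\<close>

text \<open>Here \<open>r\<close> stands for |x - x0| and \<open>\<delta>\<close> for the value of
  the barrier at the boundary point; t - t0 is bounded below by the wedge. The conditions say, in
  order: the barrier is at least \<open>M\<close> from time t0 + eta on, and on the lateral surface;
  the wedge reaches down less than eta; the barrier is a strict supersolution; it is nonnegative on
  the wedge.\<close>

definition barrier_params ::
  "real \<Rightarrow> real \<Rightarrow> real \<Rightarrow> real \<Rightarrow> real \<Rightarrow> real \<Rightarrow> real \<Rightarrow> real \<Rightarrow> real \<Rightarrow> real \<Rightarrow> real \<Rightarrow> bool" where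
  "barrier_params q l \<theta> C \<delta> \<eta> M \<beta> a b \<rho> \<longleftrightarrow>
     a > 0 \<and> b > 0 \<and> \<rho> > 0 \<and> \<rho> \<le> \<eta> \<and> b * \<eta> \<ge> M \<and> a * \<rho> powr \<beta> - b * \<theta> * \<rho> powr l \<ge> M \<and>
     (\<forall>r\<in>{0..\<rho>}. \<theta> * r powr l < \<eta> \<and> a powr (q - 1) * C * r powr ((\<beta> - 1) * (q - 1) - 1) < b \<and>
        b * \<theta> * r powr l \<le> \<delta> + a * r powr \<beta>)"

lemma barrier_params_degenerate:
  assumes q: "q > 2" and l: "l > q" and pos: "\<theta> > 0" "C > 0" "\<delta> > 0" "\<eta> > 0" "M > 0"
  shows "\<exists>a b \<rho>. barrier_params q l \<theta> C \<delta> \<eta> M q a b \<rho>"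
proof -
  \<comment> \<open>Half of \<open>K\<close>, the value of a |x|^q on the lateral surface, is spent
    on the wedge term; \<open>M\<close> is left.\<close>
  define K where "K = 2 * M"
  have K: "K > 0" using pos by (simp add: K_def)
  have lim: "((\<lambda>x::real. x powr e) \<longlongrightarrow> 0) (at_right 0)" if "e > 0" for e :: real
  proof -
    have "((\<lambda>x::real. x powr e) \<longlongrightarrow> 0 powr e) (at_right 0)"
      using that by (intro tendsto_intros) (auto simp: eventually_at_filter)
    then show ?thesis by simp
  qed
  have "\<forall>\<^sub>F \<rho> in at_right 0. \<rho> powr (l - q) < K powr (2 - q) / (2 * \<theta> * C)"
    using l K pos by (intro order_tendstoD(2)[OF lim]) auto
  moreover have "\<forall>\<^sub>F \<rho> in at_right 0. \<rho> powr l < \<eta> / \<theta>"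
    using l q pos by (intro order_tendstoD(2)[OF lim]) auto
  moreover have "\<forall>\<^sub>F \<rho> in at_right 0. \<rho> \<in> {0<..<\<eta>}"
    using pos(4) by (rule eventually_at_right_real)
  ultimately have "\<forall>\<^sub>F \<rho> in at_right (0::real). \<rho> powr (l - q) < K powr (2 - q) / (2 * \<theta> * C)
     \<and> \<rho> powr l < \<eta> / \<theta> \<and> \<rho> \<in> {0<..<\<eta>}"
    by eventually_elim simp
  then obtain \<rho> where \<rho>: "\<rho> powr (l - q) < K powr (2 - q) / (2 * \<theta> * C)" "\<rho> powr l < \<eta> / \<theta>" "\<rho> > 0" "\<rho> < \<eta>"
    using eventually_happens'[OF trivial_limit_at_right_real] by (metis (no_types, lifting) greaterThanLessThan_iff)
  \<comment> \<open>These values make \<open>a * \<rho> powr q = K\<close> and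
    \<open>b * \<theta> * \<rho> powr l = K / 2\<close>. The supersolution inequality at radius
    \<open>\<rho>\<close> then turns into the first bound imposed on \<open>\<rho>\<close>, which
    small radii satisfy because l > q.\<close>
  define a b where "a = K * \<rho> powr (- q)" and "b = K * \<rho> powr (- l) / (2 * \<theta>)"
  have ab: "a > 0" "b > 0" using K \<rho> pos by (auto simp: a_def b_def)
  have aq: "a * \<rho> powr q = K" using \<rho>(3) by (simp add: a_def powr_minus)
  have bl: "b * \<theta> * \<rho> powr l = K / 2" using \<rho>(3) pos by (simp add: b_def powr_minus)
  have "b * \<eta> = M * (\<eta> / \<theta> / \<rho> powr l)" using pos \<rho>(3) by (simp add: b_def K_def powr_minus_divide)
  also have "\<dots> \<ge> M * 1" using \<rho>(2,3) pos by (intro mult_left_mono) (auto simp: field_simps)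
  finally have D: "b * \<eta> \<ge> M" by simp
  have rest: "\<theta> * r powr l < \<eta> \<and> a powr (q - 1) * C * r powr ((q - 1) * (q - 1) - 1) < b \<and>
        b * \<theta> * r powr l \<le> \<delta> + a * r powr q" if r: "r \<in> {0..\<rho>}" for r
  proof (intro conjI)
    have rl: "r powr l \<le> \<rho> powr l" using r l q by (intro powr_mono2) auto
    also have "\<dots> < \<eta> / \<theta>" by (rule \<rho>(2))
    finally show "\<theta> * r powr l < \<eta>" using pos by (simp add: field_simps)
    have e: "(q - 1) * (q - 1) - 1 = q * (q - 2)" by (simp add: algebra_simps)
    have "a powr (q - 1) * C * r powr ((q - 1) * (q - 1) - 1)
        \<le> a powr (q - 1) * C * \<rho> powr ((q - 1) * (q - 1) - 1)"
      using r q pos e by (intro mult_left_mono powr_mono2) auto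
    also have "\<dots> = K powr (q - 1) * C * \<rho> powr (- q)"
    proof -
      have "a powr (q - 1) = K powr (q - 1) * \<rho> powr (- q * (q - 1))"
        using K \<rho>(3) by (simp add: a_def powr_mult powr_powr)
      moreover have "\<rho> powr (- q * (q - 1)) * \<rho> powr ((q - 1) * (q - 1) - 1) = \<rho> powr (- q)"
        unfolding powr_add[symmetric] by (simp add: algebra_simps)
      ultimately show ?thesis by (simp add: mult_ac)
    qed
    also have "\<dots> < b"
    proof -
      have k: "K powr (q - 1) * K powr (2 - q) = K"
        unfolding powr_add[symmetric] using K by simp
      have "K powr (q - 1) * C * \<rho> powr (- q) = K powr (q - 1) * C * \<rho> powr (- l) * \<rho> powr (l - q)"
        by (simp add: powr_add[symmetric] mult.assoc)
      also have "\<dots> < K powr (q - 1) * C * \<rho> powr (- l) * (K powr (2 - q) / (2 * \<theta> * C))"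
        using \<rho> K pos by (intro mult_strict_left_mono) auto
      also have "\<dots> = (K powr (q - 1) * K powr (2 - q)) * \<rho> powr (- l) / (2 * \<theta>)"
        using pos by (simp add: field_simps)
      finally show ?thesis unfolding k b_def .
    qed
    finally show "a powr (q - 1) * C * r powr ((q - 1) * (q - 1) - 1) < b" .
    \<comment> \<open>At radius \<open>\<rho>\<close> the wedge term is half the power term; for
      smaller \<open>r\<close> it decays faster since l > q, so it stays dominated.\<close>
    have "r / \<rho> \<le> 1" using r \<rho> by simp
    then have "(r / \<rho>) powr l \<le> (r / \<rho>) powr q"
      using r \<rho> l by (cases "r = 0") (auto intro: powr_mono')
    then have rr: "\<rho> powr (- l) * r powr l \<le> \<rho> powr (- q) * r powr q"
      using r \<rho> by (simp add: powr_divide powr_minus_divide)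
    have "b * \<theta> * r powr l = K / 2 * (\<rho> powr (- l) * r powr l)"
      using pos by (simp add: b_def)
    also have "\<dots> \<le> K / 2 * (\<rho> powr (- q) * r powr q)"
      using K by (intro mult_left_mono rr) auto
    also have "\<dots> = a * r powr q / 2" by (simp add: a_def)
    also have "\<dots> \<le> a * r powr q" using ab by simp
    finally show "b * \<theta> * r powr l \<le> \<delta> + a * r powr q" using pos by simp
  qed
  have "barrier_params q l \<theta> C \<delta> \<eta> M q a b \<rho>"
    unfolding barrier_params_def using ab \<rho>(3,4) D rest aq bl by (auto simp: K_def)
  then show ?thesis by blast
qed

text \<open>The exponent is k (3 - q) with k = q/(q-1), chosen so that beta - k = k (2 - q): the
  radius where the wedge term for l = k crosses the power term then satisfies r^k = const / a. The
  exponent of |x| in the operator becomes q (2 - q) > 0.\<close>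

lemma barrier_params_singular:
  assumes q: "1 < q" "q < 2" and l: "l \<ge> q / (q - 1)"
    and pos: "\<theta> > 0" "C > 0" "\<delta> > 0" "\<eta> > 0" "M > 0"
  shows "\<exists>a b \<rho>. barrier_params q l \<theta> C \<delta> \<eta> M (q / (q - 1) * (3 - q)) a b \<rho>"
proof -
  define k where "k = q / (q - 1)"
  define \<beta> where "\<beta> = k * (3 - q)"
  have k: "k > 2" using q by (simp add: k_def field_simps)
  have \<beta>k: "\<beta> - k = k * (2 - q)" by (simp add: \<beta>_def algebra_simps)
  have s: "(\<beta> - 1) * (q - 1) - 1 = q * (2 - q)"
  proof -
    have "\<beta> * (q - 1) = q * (3 - q)" using q by (simp add: \<beta>_def k_def)
    then show ?thesis by (simp add: algebra_simps)
  qed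
  \<comment> \<open>With \<open>\<rho> \<le> 1\<close>, larger exponents give smaller powers: this
    reduces l to k and bounds r^l by r, so the third entry yields
    \<open>\<theta> * r powr l < \<eta>\<close>.\<close>
  define \<rho> where "\<rho> = min 1 (min \<eta> (\<eta> / (2 * \<theta>)))"
  have \<rho>: "\<rho> > 0" "\<rho> \<le> 1" "\<rho> \<le> \<eta>" "\<theta> * \<rho> < \<eta>"
  proof -
    show "\<rho> > 0" "\<rho> \<le> 1" "\<rho> \<le> \<eta>" using pos by (auto simp: \<rho>_def)
    have "\<theta> * \<rho> \<le> \<theta> * (\<eta> / (2 * \<theta>))" using pos by (intro mult_left_mono) (auto simp: \<rho>_def)
    then show "\<theta> * \<rho> < \<eta>" using pos by simp
  qed
  have lk: "r powr l \<le> r powr k" if "r \<in> {0..\<rho>}" for r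
    using that \<rho> l by (cases "r = 0") (auto simp: k_def intro: powr_mono')
  \<comment> \<open>Twice the spatial operator at radius \<open>\<rho>\<close> for a = 1; the factor
    two yields strictness.\<close>
  define c where "c = 2 * C * \<rho> powr ((\<beta> - 1) * (q - 1) - 1)"
  define K where "K = c * \<theta>"
  have c: "c > 0" and K: "K > 0" using pos \<rho> by (auto simp: c_def K_def)
  have t0: "((\<lambda>a. a powr (q - 2)) \<longlongrightarrow> 0) at_top"
    using q by (intro tendsto_neg_powr filterlim_ident) auto
  \<comment> \<open>Chosen so that, below the crossing radius, the wedge term for l = k is at most
    \<open>\<kappa> * a powr (q - 2)\<close>.\<close>
  define \<kappa> where "\<kappa> = K * K powr (1 / (2 - q))"
  have "\<forall>\<^sub>F a in at_top. a powr (q - 2) < \<delta> / \<kappa>"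
    using K pos by (intro order_tendstoD(2)[OF t0]) (auto simp: \<kappa>_def)
  moreover have "\<forall>\<^sub>F a in at_top. a powr (q - 2) < \<rho> powr \<beta> / (2 * K * \<rho> powr l)"
    using K \<rho> by (intro order_tendstoD(2)[OF t0]) auto
  moreover have "\<forall>\<^sub>F a::real in at_top. a \<ge> (M / (c * \<eta>)) powr (1 / (q - 1))" by (rule eventually_ge_at_top)
  moreover have "\<forall>\<^sub>F a::real in at_top. a \<ge> 2 * M / \<rho> powr \<beta>" by (rule eventually_ge_at_top)
  moreover have "\<forall>\<^sub>F a::real in at_top. a > 0" by (rule eventually_gt_at_top)
  ultimately have "\<forall>\<^sub>F a in at_top. a powr (q - 2) < \<delta> / \<kappa> \<and> a powr (q - 2) < \<rho> powr \<beta> / (2 * K * \<rho> powr l)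
      \<and> a \<ge> (M / (c * \<eta>)) powr (1 / (q - 1)) \<and> a \<ge> 2 * M / \<rho> powr \<beta> \<and> a > 0"
    by eventually_elim simp
  then obtain a where a: "a powr (q - 2) < \<delta> / \<kappa>" "a powr (q - 2) < \<rho> powr \<beta> / (2 * K * \<rho> powr l)"
      "a \<ge> (M / (c * \<eta>)) powr (1 / (q - 1))" "a \<ge> 2 * M / \<rho> powr \<beta>" "a > 0"
    using eventually_happens'[OF trivial_limit_at_top_linorder] by (metis (no_types, lifting))
  define b where "b = c * a powr (q - 1)"
  have b: "b > 0" using c a by (simp add: b_def)
  have b\<theta>: "b * \<theta> = K * a powr (q - 1)" by (simp add: b_def K_def)
  have a1: "a powr (q - 1) = a * a powr (q - 2)"
    using a(5) powr_add[of a 1 "q - 2"] by simp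
  have "M / (c * \<eta>) = ((M / (c * \<eta>)) powr (1 / (q - 1))) powr (q - 1)"
    using q c pos by (simp add: powr_powr)
  also have "\<dots> \<le> a powr (q - 1)"
    using a(3) q by (intro powr_mono2) auto
  finally have bM: "b * \<eta> \<ge> M" using c pos by (simp add: b_def field_simps)
  have side: "a * \<rho> powr \<beta> - b * \<theta> * \<rho> powr l \<ge> M"
  proof -
    have "b * \<theta> * \<rho> powr l = a * (K * \<rho> powr l) * a powr (q - 2)" by (simp add: b\<theta> a1)
    also have "\<dots> \<le> a * (K * \<rho> powr l) * (\<rho> powr \<beta> / (2 * K * \<rho> powr l))"
      using a K by (intro mult_left_mono) auto
    also have "\<dots> = a * \<rho> powr \<beta> / 2" using K \<rho> by simp
    finally have "a * \<rho> powr \<beta> - b * \<theta> * \<rho> powr l \<ge> a * \<rho> powr \<beta> / 2" by simp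
    moreover have "a * \<rho> powr \<beta> / 2 \<ge> M" using a(4) \<rho> by (simp add: field_simps)
    ultimately show ?thesis by linarith
  qed
  have rest: "\<theta> * r powr l < \<eta> \<and> a powr (q - 1) * C * r powr ((\<beta> - 1) * (q - 1) - 1) < b \<and>
        b * \<theta> * r powr l \<le> \<delta> + a * r powr \<beta>" if r: "r \<in> {0..\<rho>}" for r
  proof (intro conjI)
    have "r powr l \<le> r powr 1"
      using r \<rho>(2) l k powr_mono'[of 1 l r] by (simp add: k_def)
    then have "\<theta> * r powr l \<le> \<theta> * \<rho>" using r pos by simp
    then show "\<theta> * r powr l < \<eta>" using \<rho>(4) by linarith
    have "a powr (q - 1) * C * r powr ((\<beta> - 1) * (q - 1) - 1)
      \<le> a powr (q - 1) * C * \<rho> powr ((\<beta> - 1) * (q - 1) - 1)"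
      using r pos q s by (intro mult_left_mono powr_mono2) auto
    also have "\<dots> = b / 2" by (simp add: b_def c_def)
    also have "\<dots> < b" using b by simp
    finally show "a powr (q - 1) * C * r powr ((\<beta> - 1) * (q - 1) - 1) < b" .
    have "b * \<theta> * r powr k \<le> \<delta> + a * r powr \<beta>"
    proof (cases "b * \<theta> * r powr k \<le> a * r powr \<beta>")
      case True
      then show ?thesis using pos by simp
    next
      \<comment> \<open>Here \<open>r\<close> is below the crossing radius, so r^(k(2-q)) is at most
        K a^(q-2), hence r^k is at most K^(1/(2-q)) / a, and the wedge term is absorbed by
        \<open>\<delta>\<close>.\<close>
      case False
      then have r0: "r > 0" using r by (cases "r = 0") auto
      have "r powr \<beta> = r powr k * r powr (k * (2 - q))"
        unfolding powr_add[symmetric] \<beta>k[symmetric] by simp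
      then have "a * r powr (k * (2 - q)) * r powr k < b * \<theta> * r powr k" using False by (simp add: mult_ac)
      then have "a * r powr (k * (2 - q)) < b * \<theta>" using r0 by (simp add: mult_less_cancel_right)
      moreover have "b * \<theta> = a * (K * a powr (q - 2))" by (simp add: b\<theta> a1)
      ultimately have "a * r powr (k * (2 - q)) < a * (K * a powr (q - 2))" by (simp only:)
      then have lt: "r powr (k * (2 - q)) \<le> K * a powr (q - 2)" using a(5) by simp
      have "r powr k = (r powr (k * (2 - q))) powr (1 / (2 - q))"
        using q by (simp add: powr_powr)
      also have "\<dots> \<le> (K * a powr (q - 2)) powr (1 / (2 - q))"
        using lt q by (intro powr_mono2) auto
      also have "\<dots> = K powr (1 / (2 - q)) * a powr ((q - 2) * (1 / (2 - q)))"
        using K a(5) by (simp add: powr_mult powr_powr)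
      also have "(q - 2) * (1 / (2 - q)) = -1" using q by (simp add: field_simps)
      finally have "b * \<theta> * r powr k \<le> b * \<theta> * (K powr (1 / (2 - q)) * a powr -1)"
        using b pos by (intro mult_left_mono) auto
      also have "\<dots> = \<kappa> * (a powr (q - 1) * a powr -1)" by (simp add: b\<theta> \<kappa>_def)
      also have "a powr (q - 1) * a powr -1 = a powr (q - 2)"
        unfolding powr_add[symmetric] by simp
      also have "\<kappa> * a powr (q - 2) \<le> \<kappa> * (\<delta> / \<kappa>)"
        using a(1) K by (intro mult_left_mono) (auto simp: \<kappa>_def)
      also have "\<dots> = \<delta>" using K by (simp add: \<kappa>_def)
      finally show ?thesis using a(5) by (simp add: add_increasing2)
    qed
    moreover have "b * \<theta> * r powr l \<le> b * \<theta> * r powr k"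
      using lk[OF r] b pos by (intro mult_left_mono) auto
    ultimately show "b * \<theta> * r powr l \<le> \<delta> + a * r powr \<beta>" by (rule order_trans[rotated])
  qed
  have "barrier_params q l \<theta> C \<delta> \<eta> M \<beta> a b \<rho>"
    unfolding barrier_params_def using a(5) b \<rho> bM side rest by auto
  then show ?thesis unfolding \<beta>_def k_def by blast
qed

section \<open>Regularity\<close>

text \<open>Turns the scalar inequalities of \<open>barrier_params\<close> into geometry. The
  distance \<open>2 * \<eta>\<close> is split evenly: at most \<open>\<eta>\<close> of it is
  horizontal in the cylinder, so at least \<open>\<eta>\<close> is in time.\<close>

lemma wedge_barrier:
  fixes \<Theta> :: "((real^'n) \<times> real) set"
  assumes p: "p > 1" and q: "q > 1" "q \<noteq> 2" and \<theta>: "\<theta> > 0"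
    and sub: "\<Theta> \<subseteq> {(x, t). t - t0 > - \<theta> * norm (x - x0) powr l}"
    and l: "q < 2 \<Longrightarrow> l \<ge> q / (q - 1)" "q > 2 \<Longrightarrow> l > q"
    and pos: "\<delta> > 0" "\<eta> > 0" "M > 0"
  obtains \<beta> a b \<rho> where "\<beta> > 2" "(\<beta> - 1) * (q - 1) > 1" "a \<ge> 0" "\<rho> > 0"
    "\<And>x. norm (x - x0) \<le> \<rho> \<Longrightarrow> a powr (q - 1) * radial_const p q \<beta> CARD('n)
      * norm (x - x0) powr ((\<beta> - 1) * (q - 1) - 1) < b"
    "\<And>\<xi>. \<xi> \<in> closure \<Theta> \<Longrightarrow> norm (fst \<xi> - x0) \<le> \<rho> \<Longrightarrow> 0 \<le> barrier \<beta> x0 t0 \<delta> a b \<xi>"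
    "\<And>\<xi>. \<xi> \<in> closure \<Theta> \<Longrightarrow> norm (fst \<xi> - x0) \<le> \<rho> \<Longrightarrow> 2 * \<eta> \<le> dist \<xi> (x0, t0) \<Longrightarrow>
      M \<le> barrier \<beta> x0 t0 \<delta> a b \<xi>"
    "\<And>\<xi>. \<xi> \<in> closure \<Theta> \<Longrightarrow> norm (fst \<xi> - x0) = \<rho> \<Longrightarrow> M \<le> barrier \<beta> x0 t0 \<delta> a b \<xi>"
proof -
  define \<beta> where "\<beta> = (if q < 2 then q / (q - 1) * (3 - q) else q)"
  have \<beta>: "\<beta> > 2 \<and> (\<beta> - 1) * (q - 1) > 1"
  proof (cases "q < 2")
    case True
    have "0 < (2 - q) * (q - 1)" using True q by simp
    then have "\<beta> > 2" using True q(1) by (simp add: \<beta>_def field_simps)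
    moreover have "(\<beta> - 1) * (q - 1) - 1 = q * (2 - q)"
    proof -
      have "\<beta> * (q - 1) = q * (3 - q)" using q True by (simp add: \<beta>_def)
      then show ?thesis by (simp add: algebra_simps)
    qed
    moreover have "q * (2 - q) > 0" using True q by simp
    ultimately show ?thesis by linarith
  next
    case False
    then have "q * (q - 2) > 0" using q by simp
    then show ?thesis using False q by (simp add: \<beta>_def algebra_simps)
  qed
  define C where "C = radial_const p q \<beta> CARD('n)"
  have C: "C > 0" unfolding C_def using p \<beta> by (intro radial_const_pos) auto
  have "\<exists>a b \<rho>. barrier_params q l \<theta> C \<delta> \<eta> M \<beta> a b \<rho>"
    using barrier_params_singular[OF q(1) _ l(1) \<theta> C pos] barrier_params_degenerate[OF _ l(2) \<theta> C pos] q(2)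
    by (auto simp: \<beta>_def)
  then obtain a b \<rho> where P: "barrier_params q l \<theta> C \<delta> \<eta> M \<beta> a b \<rho>" by blast
  then have ab: "a > 0" "b > 0" "\<rho> > 0" "\<rho> \<le> \<eta>" "b * \<eta> \<ge> M" "a * \<rho> powr \<beta> - b * \<theta> * \<rho> powr l \<ge> M"
    and r: "\<And>r. 0 \<le> r \<Longrightarrow> r \<le> \<rho> \<Longrightarrow> \<theta> * r powr l < \<eta>"
      "\<And>r. 0 \<le> r \<Longrightarrow> r \<le> \<rho> \<Longrightarrow> a powr (q - 1) * C * r powr ((\<beta> - 1) * (q - 1) - 1) < b"
      "\<And>r. 0 \<le> r \<Longrightarrow> r \<le> \<rho> \<Longrightarrow> b * \<theta> * r powr l \<le> \<delta> + a * r powr \<beta>"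
    unfolding barrier_params_def by auto
  have l0: "l > 0" using l q by (cases "q < 2") (auto intro: less_le_trans[of 0 "q / (q - 1)"])
  \<comment> \<open>The strict wedge inequality passes to the closure as a weak one;
    \<open>l0\<close> gives continuity of the power at \<open>x0\<close>.\<close>
  have cl: "snd \<xi> - t0 \<ge> - \<theta> * norm (fst \<xi> - x0) powr l" if "\<xi> \<in> closure \<Theta>" for \<xi>
  proof -
    have "closed {\<xi>. - \<theta> * norm (fst \<xi> - x0) powr l \<le> snd \<xi> - t0}"
      using l0 by (intro closed_Collect_le continuous_on_mult continuous_on_powr' continuous_intros) auto
    moreover have "\<Theta> \<subseteq> {\<xi>. - \<theta> * norm (fst \<xi> - x0) powr l \<le> snd \<xi> - t0}"
      using sub by fastforce
    ultimately show ?thesis using that closure_minimal by blast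
  qed
  have W: "barrier \<beta> x0 t0 \<delta> a b \<xi> \<ge> \<delta> + a * norm (fst \<xi> - x0) powr \<beta> - b * \<theta> * norm (fst \<xi> - x0) powr l"
    if "\<xi> \<in> closure \<Theta>" for \<xi>
    using mult_left_mono[OF cl[OF that], of b] ab(2) by (simp add: barrier_def pnorm_def)
  show thesis
  proof (rule that[of \<beta> a \<rho> b])
    show "\<beta> > 2" "(\<beta> - 1) * (q - 1) > 1" "a \<ge> 0" "\<rho> > 0" using \<beta> ab by auto
    show "a powr (q - 1) * radial_const p q \<beta> CARD('n) * norm (x - x0) powr ((\<beta> - 1) * (q - 1) - 1) < b"
      if "norm (x - x0) \<le> \<rho>" for x using r(2)[OF _ that] by (simp add: C_def)
    show "0 \<le> barrier \<beta> x0 t0 \<delta> a b \<xi>" if "\<xi> \<in> closure \<Theta>" "norm (fst \<xi> - x0) \<le> \<rho>" for \<xi>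
      using W[OF that(1)] r(3)[OF _ that(2)] by simp
    show "M \<le> barrier \<beta> x0 t0 \<delta> a b \<xi>" if "\<xi> \<in> closure \<Theta>" "norm (fst \<xi> - x0) = \<rho>" for \<xi>
      using W[OF that(1)] that(2) ab(6) pos by simp
    show "M \<le> barrier \<beta> x0 t0 \<delta> a b \<xi>"
      if "\<xi> \<in> closure \<Theta>" "norm (fst \<xi> - x0) \<le> \<rho>" "2 * \<eta> \<le> dist \<xi> (x0, t0)" for \<xi>
    proof -
      have "dist \<xi> (x0, t0) \<le> norm (fst \<xi> - x0) + \<bar>snd \<xi> - t0\<bar>"
        using norm_Pair_le[of "fst \<xi> - x0" "snd \<xi> - t0"] by (cases \<xi>) (simp add: dist_norm)
      then have "\<eta> \<le> \<bar>snd \<xi> - t0\<bar>" using that(2,3) ab(4) by linarith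
      \<comment> \<open>The wedge reaches down less than \<open>\<eta>\<close>, so the point must
        lie above t0.\<close>
      then have "\<eta> \<le> snd \<xi> - t0" using cl[OF that(1)] r(1)[OF _ that(2)] by simp
      then have "b * \<eta> \<le> b * (snd \<xi> - t0)" using ab by (intro mult_left_mono) auto
      moreover have "0 \<le> a * pnorm \<beta> (fst \<xi> - x0)" using ab by simp
      ultimately show ?thesis unfolding barrier_def using ab(5) pos(1) by linarith
    qed
  qed
qed

text \<open>Near the boundary point the Perron solution is caught between f(xi0) - eps - W and
  f(xi0) + eps + W. Since W equals eps at xi0, it is below 2 eps nearby, which accounts for the
  final 3 eps.\<close>

theorem proposition7p2:
  fixes p q l \<theta> :: real
    and \<Theta> :: "((real^'n) \<times> real) set"
    and x0 :: "real^'n" and t0 :: real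
  assumes "p > 1" and "q > 1" and "q \<noteq> 2"
    and "open \<Theta>" and "bounded \<Theta>"
    and "(x0, t0) \<in> frontier \<Theta>"
    and "\<theta> > 0"
    and "\<Theta> \<subseteq> {(x, t). t - t0 > - \<theta> * norm (x - x0) powr l}"
    and "q < 2 \<Longrightarrow> l \<ge> q / (q - 1)"
    and "q > 2 \<Longrightarrow> l > q"
  shows "regular_boundary_point p q \<Theta> (x0, t0)"
proof -
  note p = \<open>p > 1\<close> and \<Theta> = \<open>open \<Theta>\<close>
  define \<xi>0 where "\<xi>0 = (x0, t0)"
  have "(upper_Perron p q \<Theta> f \<longlongrightarrow> ereal (f \<xi>0)) (at \<xi>0 within \<Theta>)"
    if f: "continuous_on (frontier \<Theta>) f" for f
  proof -

    \<comment> \<open>A lower bound common to the whole upper class\<close>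
    have "compact (frontier \<Theta>)" using \<open>bounded \<Theta>\<close> by (rule compact_frontier_bounded)
    then have "bounded (f ` frontier \<Theta>)" using f by (intro compact_imp_bounded compact_continuous_image)
    then obtain B where B: "B > 0" "\<And>\<xi>. \<xi> \<in> frontier \<Theta> \<Longrightarrow> \<bar>f \<xi>\<bar> \<le> B"
      by (auto simp: bounded_pos)
    have fr_cl: "\<xi> \<in> closure \<Theta>" if "\<xi> \<in> frontier \<Theta>" for \<xi> using that by (simp add: frontier_def)
    have "bounded (closure \<Theta>)" using \<open>bounded \<Theta>\<close> by (rule bounded_closure)
    then have "bounded ((\<lambda>\<xi>. snd \<xi> - t0) ` closure \<Theta>)"
      by (intro bounded_minus_comp bounded_snd) (auto simp: image_constant_conv)
    then obtain T where T: "T > 0" "\<And>\<xi>. \<xi> \<in> closure \<Theta> \<Longrightarrow> \<bar>snd \<xi> - t0\<bar> \<le> T"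
      by (auto simp: bounded_pos)
    define M0 where "M0 = B + 2 * T"
    have crude: "ereal (- M0) \<le> u \<xi>" if u: "u \<in> upper_class p q \<Theta> f" and \<xi>: "\<xi> \<in> \<Theta>" for u \<xi>
    proof -
      obtain m where m: "\<And>\<xi>. \<xi> \<in> \<Theta> \<Longrightarrow> ereal m \<le> u \<xi>" using u by (auto simp: upper_class_def)
      \<comment> \<open>The comparison function depends on t alone (a = 0, b = 1); the exponent
        enters only through the penalties, and this value meets both conditions for every q >
        1.\<close>
      define \<beta> where "\<beta> = 3 + 1 / (q - 1)"
      have "(\<beta> - 1) * (q - 1) = 2 * (q - 1) + 1"
        using \<open>q > 1\<close> by (simp add: \<beta>_def add_divide_distrib distrib_right left_diff_distrib)
      then have \<beta>: "\<beta> > 2" "(\<beta> - 1) * (q - 1) > 1"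
        using \<open>q > 1\<close> by (auto simp: \<beta>_def intro: add_strict_increasing2)
      have k: "barrier \<beta> x0 t0 (- B - T) (- 0) (- 1) \<zeta> = - B - T - (snd \<zeta> - t0)" for \<zeta>
        by (simp add: barrier_def)
      have "ereal (barrier \<beta> x0 t0 (- B - T) (- 0) (- 1) \<xi>) \<le> u \<xi>"
      proof (rule supersol_ge_barrier[OF p \<beta> \<Theta> _ \<Theta> order_refl \<open>bounded \<Theta>\<close> m _ _ _ \<xi>])
        show "viscosity_supersol p q \<Theta> u" using u by (simp add: upper_class_def)
        fix \<zeta> assume \<zeta>: "\<zeta> \<in> frontier \<Theta>"
        have "barrier \<beta> x0 t0 (- B - T) (- 0) (- 1) \<zeta> \<le> f \<zeta>"
          unfolding k using B(2)[OF \<zeta>] T(2)[OF fr_cl[OF \<zeta>]] by linarith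
        also have "ereal (f \<zeta>) \<le> Liminf (at \<zeta> within \<Theta>) u"
          using u \<zeta> by (simp add: upper_class_def)
        finally show "ereal (barrier \<beta> x0 t0 (- B - T) (- 0) (- 1) \<zeta>) \<le> Liminf (at \<zeta> within \<Theta>) u" by simp
      qed auto
      moreover have "- M0 \<le> barrier \<beta> x0 t0 (- B - T) (- 0) (- 1) \<xi>"
        unfolding k M0_def using T(2)[of \<xi>] \<xi> closure_subset[of \<Theta>] by fastforce
      ultimately show ?thesis by (meson ereal_less_eq(3) order_trans)
    qed
    have near: "\<forall>\<^sub>F \<xi> in at \<xi>0 within \<Theta>. ereal (f \<xi>0 - 3 * \<epsilon>) < upper_Perron p q \<Theta> f \<xi> \<and>
        upper_Perron p q \<Theta> f \<xi> < ereal (f \<xi>0 + 3 * \<epsilon>)" if \<epsilon>: "\<epsilon> > 0" for \<epsilon> :: real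
    proof -
      have \<xi>0: "\<xi>0 \<in> frontier \<Theta>" using assms by (simp add: \<xi>0_def)
      obtain d where d: "d > 0" "\<And>\<xi>. \<xi> \<in> frontier \<Theta> \<Longrightarrow> dist \<xi> \<xi>0 < d \<Longrightarrow> \<bar>f \<xi> - f \<xi>0\<bar> < \<epsilon>"
        using f \<xi>0 \<epsilon> unfolding continuous_on_iff dist_real_def by meson
      \<comment> \<open>The part \<open>2 * B\<close> bounds the oscillation of f on the frontier;
        adding \<open>M0\<close> pushes the lower barrier below the common bound \<open>- M0\<close>
        on the lateral surface.\<close>
      define M where "M = 2 * B + M0"
      have M: "M > 0" using B T by (simp add: M_def M0_def)
      obtain \<beta> a b \<rho> where \<beta>: "\<beta> > 2" "(\<beta> - 1) * (q - 1) > 1" and a: "a \<ge> 0" and \<rho>: "\<rho> > 0"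
        and b: "\<And>x. norm (x - x0) \<le> \<rho> \<Longrightarrow> a powr (q - 1) * radial_const p q \<beta> CARD('n)
          * norm (x - x0) powr ((\<beta> - 1) * (q - 1) - 1) < b"
        and W0: "\<And>\<xi>. \<xi> \<in> closure \<Theta> \<Longrightarrow> norm (fst \<xi> - x0) \<le> \<rho> \<Longrightarrow> 0 \<le> barrier \<beta> x0 t0 \<epsilon> a b \<xi>"
        and WM: "\<And>\<xi>. \<xi> \<in> closure \<Theta> \<Longrightarrow> norm (fst \<xi> - x0) \<le> \<rho> \<Longrightarrow> 2 * (d / 2) \<le> dist \<xi> (x0, t0) \<Longrightarrow>
          M \<le> barrier \<beta> x0 t0 \<epsilon> a b \<xi>"
        and WS: "\<And>\<xi>. \<xi> \<in> closure \<Theta> \<Longrightarrow> norm (fst \<xi> - x0) = \<rho> \<Longrightarrow> M \<le> barrier \<beta> x0 t0 \<epsilon> a b \<xi>"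
        using d(1) by (rule_tac wedge_barrier[OF assms(1,2,3,7,8,9,10) \<epsilon> _ M, where \<eta> = "d / 2"]) (auto simp del: times_divide_eq_right)
      define W where "W = barrier \<beta> x0 t0 \<epsilon> a b"
      \<comment> \<open>One eps allows for the oscillation of f near xi0, the other is the value of
        W at xi0.\<close>
      have Wup: "barrier \<beta> x0 t0 (f \<xi>0 + 2 * \<epsilon>) a b \<xi> = f \<xi>0 + \<epsilon> + W \<xi>" for \<xi>
        by (simp add: W_def barrier_def)
      have Wlo: "barrier \<beta> x0 t0 (f \<xi>0 - 2 * \<epsilon>) (- a) (- b) \<xi> = f \<xi>0 - \<epsilon> - W \<xi>" for \<xi>
        by (simp add: W_def barrier_def)
      have f0: "\<bar>f \<xi>0\<bar> \<le> B" using B \<xi>0 by blast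
      have fW: "\<bar>f \<xi> - f \<xi>0\<bar> \<le> \<epsilon> + W \<xi>" if "\<xi> \<in> frontier \<Theta>" "norm (fst \<xi> - x0) \<le> \<rho>" for \<xi>
      proof (cases "dist \<xi> \<xi>0 < d")
        case True
        then show ?thesis using d(2)[OF that(1)] W0[OF fr_cl[OF that(1)] that(2)] by (simp add: W_def)
      next
        case False
        then have "M \<le> W \<xi>" using WM[OF fr_cl[OF that(1)] that(2)] by (simp add: W_def \<xi>0_def)
        then show ?thesis using B(2)[OF that(1)] f0 \<epsilon> T B(1) by (simp add: M_def M0_def)
      qed

      \<comment> \<open>The lower bound by comparison in the cylinder\<close>
      define cyl where "cyl = {\<xi> :: (real^'n) \<times> real. norm (fst \<xi> - x0) < \<rho>}"
      have cyl: "open cyl" unfolding cyl_def by (intro open_Collect_less continuous_intros)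
      have lower: "ereal (f \<xi>0 - \<epsilon> - W \<xi>) \<le> upper_Perron p q \<Theta> f \<xi>" if \<xi>: "\<xi> \<in> \<Theta> \<inter> cyl" for \<xi>
        unfolding upper_Perron_def
      proof (rule INF_greatest)
        fix u assume u: "u \<in> upper_class p q \<Theta> f"
        have "ereal (barrier \<beta> x0 t0 (f \<xi>0 - 2 * \<epsilon>) (- a) (- b) \<xi>) \<le> u \<xi>"
        proof (rule supersol_ge_barrier[OF p \<beta> \<Theta> _ _ _ _ _ a _ _ \<xi>])
          show "viscosity_supersol p q \<Theta> u" using u by (simp add: upper_class_def)
          show "open (\<Theta> \<inter> cyl)" "\<Theta> \<inter> cyl \<subseteq> \<Theta>" using \<Theta> cyl by auto
          show "bounded (\<Theta> \<inter> cyl)" using \<open>bounded \<Theta>\<close> by (rule bounded_subset) auto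
          show "ereal (- M0) \<le> u \<zeta>" if "\<zeta> \<in> \<Theta> \<inter> cyl" for \<zeta> using crude[OF u] that by simp
          show "a powr (q - 1) * radial_const p q \<beta> CARD('n)
            * norm (fst \<zeta> - x0) powr ((\<beta> - 1) * (q - 1) - 1) < b" if "\<zeta> \<in> \<Theta> \<inter> cyl" for \<zeta>
            using that by (intro b) (simp add: cyl_def)
          fix \<zeta> assume fr: "\<zeta> \<in> frontier (\<Theta> \<inter> cyl)"
          then have cl: "\<zeta> \<in> closure (\<Theta> \<inter> cyl)" and n: "\<zeta> \<notin> \<Theta> \<inter> cyl"
            using \<Theta> cyl by (auto simp: frontier_def interior_open open_Int)
          have cl\<Theta>: "\<zeta> \<in> closure \<Theta>" using cl closure_mono[of "\<Theta> \<inter> cyl" \<Theta>] by auto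
          have "closed {\<xi> :: (real^'n) \<times> real. norm (fst \<xi> - x0) \<le> \<rho>}"
            by (intro closed_Collect_le continuous_intros)
          moreover have "\<Theta> \<inter> cyl \<subseteq> {\<xi>. norm (fst \<xi> - x0) \<le> \<rho>}" by (auto simp: cyl_def)
          ultimately have r: "norm (fst \<zeta> - x0) \<le> \<rho>" using cl closure_minimal by blast
          show "ereal (barrier \<beta> x0 t0 (f \<xi>0 - 2 * \<epsilon>) (- a) (- b) \<zeta>) \<le> Liminf (at \<zeta> within \<Theta> \<inter> cyl) u"
          \<comment> \<open>A frontier point inside Theta lies on the lateral surface, where only
            the common bound is available and W is at least \<open>M\<close>. Elsewhere the boundary
            data control \<open>u\<close>.\<close>
          proof (cases "\<zeta> \<in> \<Theta>")
            case True
            then have "norm (fst \<zeta> - x0) = \<rho>" using n r by (simp add: cyl_def)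
            then have "M \<le> W \<zeta>" using WS[OF cl\<Theta>] by (simp add: W_def)
            then have "barrier \<beta> x0 t0 (f \<xi>0 - 2 * \<epsilon>) (- a) (- b) \<zeta> \<le> - M0"
              unfolding Wlo using f0 B(1) \<epsilon> by (simp add: M_def)
            also have "ereal (- M0) \<le> Liminf (at \<zeta> within \<Theta> \<inter> cyl) u"
              by (rule Liminf_bounded) (auto simp: eventually_at_filter intro!: always_eventually crude[OF u])
            finally show ?thesis by simp
          next
            case False
            then have z: "\<zeta> \<in> frontier \<Theta>" using cl\<Theta> \<Theta> by (simp add: frontier_def interior_open)
            have "barrier \<beta> x0 t0 (f \<xi>0 - 2 * \<epsilon>) (- a) (- b) \<zeta> \<le> f \<zeta>"
              unfolding Wlo using fW[OF z r] by linarith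
            also have "ereal (f \<zeta>) \<le> Liminf (at \<zeta> within \<Theta>) u"
              using u z by (simp add: upper_class_def)
            also have "\<dots> \<le> Liminf (at \<zeta> within \<Theta> \<inter> cyl) u"
              unfolding le_Liminf_iff[of "Liminf (at \<zeta> within \<Theta>) u"]
              by (blast intro: filter_leD[OF at_le[OF Int_lower1]] less_LiminfD)
            finally show ?thesis by simp
          qed
        qed
        then show "ereal (f \<xi>0 - \<epsilon> - W \<xi>) \<le> u \<xi>" by (simp add: Wlo)
      qed

      \<comment> \<open>The upper bound by a capped barrier\<close>
      define U where "U = capped_barrier \<beta> x0 t0 (f \<xi>0 + 2 * \<epsilon>) a b \<rho> B"
      have BW: "B \<le> barrier \<beta> x0 t0 (f \<xi>0 + 2 * \<epsilon>) a b \<xi>"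
        if "\<xi> \<in> closure \<Theta>" "norm (fst \<xi> - x0) = \<rho>" for \<xi>
        unfolding Wup using WS[OF that] f0 \<epsilon> T(1) B(1) by (simp add: W_def M_def M0_def)
      have "(\<lambda>\<xi>. ereal (U \<xi>)) \<in> upper_class p q \<Theta> f"
        unfolding upper_class_def mem_Collect_eq
      proof (intro conjI ballI exI)
        show "viscosity_supersol p q \<Theta> (\<lambda>\<xi>. ereal (U \<xi>))"
          unfolding U_def by (rule capped_barrier_supersol[OF p \<beta>(1) \<Theta> a less_imp_le[OF b] BW])
        show "ereal (- B) \<le> ereal (U \<xi>)" if "\<xi> \<in> \<Theta>" for \<xi>
        proof -
          have "\<xi> \<in> closure \<Theta>" using that closure_subset by blast
          then show ?thesis
            using W0[of \<xi>] f0 \<epsilon> B(1) by (auto simp: U_def capped_barrier_def Wup W_def)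
        qed
        fix \<xi> assume fr: "\<xi> \<in> frontier \<Theta>"
        have "continuous_on (closure \<Theta>) U"
          unfolding U_def by (rule continuous_on_capped_barrier[OF \<beta>(1) BW])
        moreover have "f \<xi> \<le> U \<xi>" using fW[OF fr] B(2)[OF fr] by (auto simp: U_def capped_barrier_def Wup)
        ultimately show "ereal (f \<xi>) \<le> Liminf (at \<xi> within \<Theta>) (\<lambda>\<xi>. ereal (U \<xi>))"
          by (rule le_Liminf_continuous[OF _ fr_cl[OF fr]])
      qed
      then have "upper_Perron p q \<Theta> f \<xi> \<le> ereal (U \<xi>)" for \<xi>
        unfolding upper_Perron_def by (rule INF_lower)
      moreover have "U \<xi> \<le> f \<xi>0 + \<epsilon> + W \<xi>" if "\<xi> \<in> \<Theta> \<inter> cyl" for \<xi>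
        using that by (simp add: U_def capped_barrier_def Wup cyl_def)
      ultimately have upper: "upper_Perron p q \<Theta> f \<xi> \<le> ereal (f \<xi>0 + \<epsilon> + W \<xi>)" if "\<xi> \<in> \<Theta> \<inter> cyl" for \<xi>
        using that by (meson ereal_less_eq(3) order_trans)
      have "isCont W \<xi>0"
        unfolding W_def
        using continuous_on_eq_continuous_at[OF open_UNIV] continuous_on_barrier[OF \<beta>(1)] by blast
      then have "(W \<longlongrightarrow> W \<xi>0) (at \<xi>0 within \<Theta>)"
        using continuous_at_imp_continuous_at_within continuous_within by blast
      moreover have "W \<xi>0 < 2 * \<epsilon>" using \<epsilon> by (simp add: W_def barrier_def \<xi>0_def)
      ultimately have "\<forall>\<^sub>F \<xi> in at \<xi>0 within \<Theta>. W \<xi> < 2 * \<epsilon>" by (rule order_tendstoD)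
      moreover have "\<forall>\<^sub>F \<xi> in at \<xi>0 within \<Theta>. \<xi> \<in> \<Theta> \<inter> cyl"
      proof -
        have "\<forall>\<^sub>F \<xi> in nhds \<xi>0. \<xi> \<in> cyl"
          using cyl \<rho> by (intro eventually_nhds_in_open) (auto simp: cyl_def \<xi>0_def)
        then show ?thesis unfolding eventually_at_filter by (rule eventually_mono) auto
      qed
      ultimately show ?thesis
      proof eventually_elim
        case (elim \<xi>)
        have "ereal (f \<xi>0 - 3 * \<epsilon>) < ereal (f \<xi>0 - \<epsilon> - W \<xi>)" using elim(1) by simp
        moreover have "ereal (f \<xi>0 + \<epsilon> + W \<xi>) < ereal (f \<xi>0 + 3 * \<epsilon>)" using elim(1) by simp
        ultimately show ?case
          using lower[OF elim(2)] upper[OF elim(2)] by (meson less_le_trans le_less_trans)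
      qed
    qed
    show ?thesis
    proof (rule order_tendstoI)
      fix y assume "y < ereal (f \<xi>0)"
      then obtain r where r: "y < ereal r" "r < f \<xi>0" using ereal_dense2 by (metis ereal_less(1) less_ereal.simps(1))
      show "\<forall>\<^sub>F \<xi> in at \<xi>0 within \<Theta>. y < upper_Perron p q \<Theta> f \<xi>"
      proof -
        have e: "f \<xi>0 - 3 * ((f \<xi>0 - r) / 3) = r" by (simp add: diff_divide_distrib)
        show ?thesis
          using near[of "(f \<xi>0 - r) / 3"] r unfolding e by (auto elim!: eventually_mono intro: less_trans)
      qed
    next
      fix y assume "ereal (f \<xi>0) < y"
      then obtain r where r: "ereal r < y" "f \<xi>0 < r" using ereal_dense2 by (metis less_ereal.simps(1))
      show "\<forall>\<^sub>F \<xi> in at \<xi>0 within \<Theta>. upper_Perron p q \<Theta> f \<xi> < y"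
      proof -
        have e: "f \<xi>0 + 3 * ((r - f \<xi>0) / 3) = r" by (simp add: diff_divide_distrib)
        show ?thesis
          using near[of "(r - f \<xi>0) / 3"] r unfolding e by (auto elim!: eventually_mono intro: less_trans)
      qed
    qed
  qed
  then show ?thesis
    using assms(6) unfolding regular_boundary_point_def \<xi>0_def by blast
qed

end
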